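(* Let $\Omega\subset\mathbb{R}^d$ ($d=2,3$) be a bounded regular domain, $\nu>0$, and let $\|\cdot\|$ and $(\cdot,\cdot)$ denote the $L^2(\Omega)$ norm and inner product. Let time-steps $k_n>0$ and artificial compression parameters $\varepsilon_n>0$ be arbitrary positive numbers, let forcing terms $f_n\in H^{-1}(\Omega)^d$ be given, and let initial data $u_0$ (and, for the extrapolation at the first step, $u_{-1}$), $p_0$ be given. Suppose $u_{n}\in H^1_0(\Omega)^d$ (so $u_n=0$ on $\partial\Omega$) and $p_n\in L^2(\Omega)$, $n\ge1$, satisfy the first-order GA-Method: for each $n\ge 0$, with $u^{\ast}=\left(1+\frac{k_{n+1}}{k_n}\right)u_n-\frac{k_{n+1}}{k_n}u_{n-1}$, $$\frac{u_{n+1}-u_{n}}{k_{n+1}}+u^{\ast}\cdot\nabla u_{n+1}+\tfrac{1}{2}(\nabla\cdot u^{\ast})u_{n+1}+\nabla p_{n+1}-\nu\Delta u_{n+1}=f_{n+1},$$ $$\frac{\varepsilon_{n+1}p_{n+1}-\sqrt{\varepsilon_{n+1}\varepsilon_n}\,p_{n}}{k_{n+1}}+\nabla\cdot u_{n+1}=0,$$ the equations being understood in the standard variational (weak) sense. Then the method is unconditionally, long-time stable: for any $N>0$ the energy equality \begin{gather*} \frac{1}{2}\int_{\Omega}|u_{N}|^{2}+\varepsilon_{N}|p_{N}|^{2}\,dx+\sum_{n=0}^{N-1}\frac{1}{2}\int_{\Omega}|u_{n+1}-u_{n}|^{2}+(\sqrt{\varepsilon_{n+1}}p_{n+1}-\sqrt{\varepsilon_{n}}p_{n})^{2}+2k_{n+1}\nu|\nabla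 u_{n+1}|^{2}\,dx\\ =\frac{1}{2}\int_{\Omega}|u_{0}|^{2}+\varepsilon_{0}|p_{0}|^{2}\,dx+\sum_{n=0}^{N-1}k_{n+1}\int_{\Omega}u_{n+1}\cdot f_{n+1}\,dx \end{gather*} holds, and the stability bound \begin{gather*} \frac{1}{2}\int_{\Omega}|u_{N}|^{2}+\varepsilon_{N}|p_{N}|^{2}\,dx+\sum_{n=0}^{N-1}\left[\frac{1}{2}\int_{\Omega}|u_{n+1}-u_{n}|^{2}+(\sqrt{\varepsilon_{n+1}}p_{n+1}-\sqrt{\varepsilon_{n}}p_{n})^{2}+k_{n+1}\nu|\nabla u_{n+1}|^{2}\,dx\right]\\ \le\frac{1}{2}\int_{\Omega}|u_{0}|^{2}+\varepsilon_{0}|p_{0}|^{2}\,dx+\sum_{n=0}^{N-1}k_{n+1}\frac{1}{2\nu}\|f_{n+1}\|_{-1}^{2} \end{gather*} holds.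
   Context: $\|\cdot\|_{-1}$ denotes the norm of the dual space $H^{-1}(\Omega)$ of $H^1_0(\Omega)$ (equipped with the norm $\|\nabla\cdot\|$). The nonlinear term is in the skew-symmetrized form $u^{\ast}\cdot\nabla u_{n+1}+\frac12(\nabla\cdot u^{\ast})u_{n+1}$. No restriction is placed on the sequences $k_n$, $\varepsilon_n$ other than positivity. *)

theory Defs
  imports "HOL-Analysis.Analysis"
begin

definition partial_deriv :: "'d::finite \<Rightarrow> (real^'d \<Rightarrow> real) \<Rightarrow> real^'d \<Rightarrow> real" where
  "partial_deriv i f x = frechet_derivative f (at x) (axis i 1)"

primrec Ck :: "nat \<Rightarrow> (real^'d::finite \<Rightarrow> real) \<Rightarrow> bool" where
  "Ck 0 f = continuous_on UNIV f"
| "Ck (Suc m) f = (f differentiable_on UNIV \<and> (\<forall>i. Ck m (partial_deriv i f)))"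

definition smooth_fun :: "(real^'d::finite \<Rightarrow> real) \<Rightarrow> bool" where
  "smooth_fun f = (\<forall>m. Ck m f)"

definition test_fun :: "(real^'d::finite) set \<Rightarrow> (real^'d \<Rightarrow> real) \<Rightarrow> bool" where
  "test_fun \<Omega> \<phi> = (smooth_fun \<phi> \<and> compact (closure {x. \<phi> x \<noteq> 0})
                     \<and> closure {x. \<phi> x \<noteq> 0} \<subseteq> \<Omega>)"

definition cgrad :: "(real^'d::finite \<Rightarrow> real^'d) \<Rightarrow> real^'d \<Rightarrow> real^'d^'d" where
  "cgrad \<phi> x = (\<chi> j i. partial_deriv i (\<lambda>y. \<phi> y $ j) x)"

definition regular_domain :: "(real^'d::finite) set \<Rightarrow> bool" where
  "regular_domain \<Omega> = (open \<Omega> \<and> connected \<Omega> \<and> bounded \<Omega> \<and> \<Omega> \<noteq> {} \<and>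
     (\<forall>x\<in>frontier \<Omega>. \<exists>r>0. \<exists>\<phi>. Ck 1 \<phi> \<and>
        (\<forall>y\<in>ball x r. (\<chi> i. partial_deriv i \<phi> y) \<noteq> 0) \<and>
        \<Omega> \<inter> ball x r = {y\<in>ball x r. \<phi> y < 0}))"

abbreviation omint :: "(real^'d::finite) set \<Rightarrow> (real^'d \<Rightarrow> real) \<Rightarrow> real" where
  "omint \<Omega> f \<equiv> integral\<^sup>L (lebesgue_on \<Omega>) f"

definition L2 :: "(real^'d::finite) set \<Rightarrow> (real^'d \<Rightarrow> 'b::euclidean_space) \<Rightarrow> bool" where
  "L2 \<Omega> u = (u \<in> borel_measurable (lebesgue_on \<Omega>) \<and>
              integrable (lebesgue_on \<Omega>) (\<lambda>x. (norm (u x))\<^sup>2))"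

definition weak_grad :: "(real^'d::finite) set \<Rightarrow> (real^'d \<Rightarrow> real^'d) \<Rightarrow> (real^'d \<Rightarrow> real^'d^'d) \<Rightarrow> bool" where
  "weak_grad \<Omega> u G = (\<forall>j i \<phi>. test_fun \<Omega> \<phi> \<longrightarrow>
      omint \<Omega> (\<lambda>x. u x $ j * partial_deriv i \<phi> x) = - omint \<Omega> (\<lambda>x. G x $ j $ i * \<phi> x))"

definition H1 :: "(real^'d::finite) set \<Rightarrow> (real^'d \<Rightarrow> real^'d) \<Rightarrow> bool" where
  "H1 \<Omega> u = (L2 \<Omega> u \<and> (\<exists>G. L2 \<Omega> G \<and> weak_grad \<Omega> u G))"

definition Grad :: "(real^'d::finite) set \<Rightarrow> (real^'d \<Rightarrow> real^'d) \<Rightarrow> real^'d \<Rightarrow> real^'d^'d" where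
  "Grad \<Omega> u = (SOME G. L2 \<Omega> G \<and> weak_grad \<Omega> u G)"

definition Div :: "(real^'d::finite) set \<Rightarrow> (real^'d \<Rightarrow> real^'d) \<Rightarrow> real^'d \<Rightarrow> real" where
  "Div \<Omega> u x = (\<Sum>j\<in>UNIV. Grad \<Omega> u x $ j $ j)"

definition H10 :: "(real^'d::finite) set \<Rightarrow> (real^'d \<Rightarrow> real^'d) \<Rightarrow> bool" where
  "H10 \<Omega> u = (H1 \<Omega> u \<and> (\<forall>e>0. \<exists>\<phi>. (\<forall>j. test_fun \<Omega> (\<lambda>x. \<phi> x $ j)) \<and>
      omint \<Omega> (\<lambda>x. (norm (u x - \<phi> x))\<^sup>2 + (norm (Grad \<Omega> u x - cgrad \<phi> x))\<^sup>2) < e))"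

definition grad_norm :: "(real^'d::finite) set \<Rightarrow> (real^'d \<Rightarrow> real^'d) \<Rightarrow> real" where
  "grad_norm \<Omega> v = sqrt (omint \<Omega> (\<lambda>x. (norm (Grad \<Omega> v x))\<^sup>2))"

definition Hm1 :: "(real^'d::finite) set \<Rightarrow> ((real^'d \<Rightarrow> real^'d) \<Rightarrow> real) \<Rightarrow> bool" where
  "Hm1 \<Omega> F = ((\<forall>v w a b. H10 \<Omega> v \<longrightarrow> H10 \<Omega> w \<longrightarrow>
                    F (\<lambda>x. a *\<^sub>R v x + b *\<^sub>R w x) = a * F v + b * F w) \<and>
               (\<exists>C. \<forall>v. H10 \<Omega> v \<longrightarrow> \<bar>F v\<bar> \<le> C * grad_norm \<Omega> v))"

definition dual_norm :: "(real^'d::finite) set \<Rightarrow> ((real^'d \<Rightarrow> real^'d) \<Rightarrow> real) \<Rightarrow> real" where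
  "dual_norm \<Omega> F = Sup {\<bar>F v\<bar> / grad_norm \<Omega> v | v. H10 \<Omega> v \<and> grad_norm \<Omega> v \<noteq> 0}"

definition bstar :: "(real^'d::finite) set \<Rightarrow> (real^'d \<Rightarrow> real^'d) \<Rightarrow> (real^'d \<Rightarrow> real^'d) \<Rightarrow> (real^'d \<Rightarrow> real^'d) \<Rightarrow> real" where
  "bstar \<Omega> w u v = omint \<Omega> (\<lambda>x. (Grad \<Omega> u x *v w x) \<bullet> v x + (1/2) * Div \<Omega> w x * (u x \<bullet> v x))"

definition ustar :: "(nat \<Rightarrow> real) \<Rightarrow> (nat \<Rightarrow> real^'d::finite \<Rightarrow> real^'d) \<Rightarrow> (real^'d \<Rightarrow> real^'d) \<Rightarrow> nat \<Rightarrow> real^'d \<Rightarrow> real^'d" where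
  "ustar k u um1 n x = (1 + k (Suc n) / k n) *\<^sub>R u n x
                        - (k (Suc n) / k n) *\<^sub>R (if n = 0 then um1 x else u (n - 1) x)"

definition GA_step :: "(real^'d::finite) set \<Rightarrow> real \<Rightarrow> (nat \<Rightarrow> real) \<Rightarrow> (nat \<Rightarrow> real) \<Rightarrow>
    (nat \<Rightarrow> (real^'d \<Rightarrow> real^'d) \<Rightarrow> real) \<Rightarrow> (nat \<Rightarrow> real^'d \<Rightarrow> real^'d) \<Rightarrow> (real^'d \<Rightarrow> real^'d) \<Rightarrow>
    (nat \<Rightarrow> real^'d \<Rightarrow> real) \<Rightarrow> nat \<Rightarrow> bool" where
  "GA_step \<Omega> \<nu> k \<epsilon> F u um1 p n =
    ((\<forall>v. H10 \<Omega> v \<longrightarrow>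
        omint \<Omega> (\<lambda>x. ((1 / k (Suc n)) *\<^sub>R (u (Suc n) x - u n x)) \<bullet> v x)
        + bstar \<Omega> (ustar k u um1 n) (u (Suc n)) v
        - omint \<Omega> (\<lambda>x. p (Suc n) x * Div \<Omega> v x)
        + \<nu> * omint \<Omega> (\<lambda>x. Grad \<Omega> (u (Suc n)) x \<bullet> Grad \<Omega> v x)
        = F (Suc n) v) \<and>
     (\<forall>q. L2 \<Omega> q \<longrightarrow>
        omint \<Omega> (\<lambda>x. (\<epsilon> (Suc n) * p (Suc n) x - sqrt (\<epsilon> (Suc n) * \<epsilon> n) * p n x) / k (Suc n) * q x)
        + omint \<Omega> (\<lambda>x. Div \<Omega> (u (Suc n)) x * q x) = 0))"

end

theory Submission
  imports Defs
begin

text \<open>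
  Testing the momentum equation with \<open>u\<^sub>n\<^sub>+\<^sub>1\<close> and the continuity equation with \<open>p\<^sub>n\<^sub>+\<^sub>1\<close> gives the
  energy identity of one step by polarization, provided that the skew-symmetrized convection term
  \<open>b(w,u,u)\<close> vanishes; the stability bound then follows from Young's inequality for the dual pairing.

  The extrapolated velocity \<open>w\<close> is only in \<open>H\<^sup>1\<close>, without zero trace, and \<open>b(w,u,u) = 0\<close> is obtained
  without any integrability of \<open>w\<close> beyond \<open>L\<^sup>2\<close>. For test fields \<open>\<phi>\<close> the bounded truncation
  \<open>|\<phi>|\<^sup>2 / (2 (1 + \<delta> |\<phi>|\<^sup>2))\<close> is again a test function, so it may be inserted in the weak definition of
  \<open>div w\<close>; since the truncation and its derivatives are bounded, the resulting identity survives the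
  \<open>H\<^sup>1\<close>-limit \<open>\<phi> \<rightarrow> u\<close>. Ladyzhenskaya's inequality in dimensions two and three gives \<open>|u|\<^sup>2 \<in> L\<^sup>2\<close>, so that
  \<open>(div w) |u|\<^sup>2\<close> is integrable and \<open>\<delta> \<rightarrow> 0\<close> is a dominated limit. If the integrand of \<open>b(w,u,u)\<close> is not
  integrable, its Bochner integral is \<open>0\<close> by convention.
\<close>

subsection \<open>Smooth test functions\<close>

lemma has_derivative_imp_partial_deriv:
  "(f has_derivative f') (at x) \<Longrightarrow> partial_deriv i f x = f' (axis i 1)"
  by (metis frechet_derivative_at partial_deriv_def)

lemma Ck_Suc_differentiable:
  assumes "Ck (Suc m) f"
  shows "(f has_derivative frechet_derivative f (at x)) (at x)"
  using assms by (auto simp: differentiable_on_def frechet_derivative_works)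

text \<open>With an explicit candidate for the derivative, the closure rules below can take it from
  the library's differentiation rules and leave only its partial derivatives to the
  induction.\<close>

lemma Ck_SucI:
  assumes "\<And>x. (f has_derivative f' x) (at x)" "\<And>i. Ck m (\<lambda>x. f' x (axis i 1))"
  shows "Ck (Suc m) f"
proof -
  have "partial_deriv i f = (\<lambda>x. f' x (axis i 1))" for i
    using has_derivative_imp_partial_deriv[OF assms(1)] by auto
  then show ?thesis
    using assms by (auto simp: differentiable_on_def differentiable_def)
qed

lemma Ck_continuous: "Ck m f \<Longrightarrow> continuous_on UNIV f"
  by (cases m) (auto intro: differentiable_imp_continuous_on)

text \<open>The product and quotient rules leave undifferentiated factors of class C^(m+1) where the
  induction asks for class C^m.\<close>

lemma Ck_SucD: "Ck (Suc m) f \<Longrightarrow> Ck m f"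
  by (induction m arbitrary: f) (auto intro: differentiable_imp_continuous_on)

lemma Ck_const: "Ck m (\<lambda>x. c)"
  by (induction m arbitrary: c)
     (auto intro!: Ck_SucI[where f' = "\<lambda>x h. 0"] simp del: Ck.simps(2))

lemma Ck_add: "Ck m f \<Longrightarrow> Ck m g \<Longrightarrow> Ck m (\<lambda>x. f x + g x)"
proof (induction m arbitrary: f g)
  case 0
  then show ?case by (auto intro!: continuous_intros)
next
  case (Suc m)
  show ?case
    by (rule Ck_SucI[OF has_derivative_add[OF Suc.prems[THEN Ck_Suc_differentiable]]])
       (use Suc in \<open>simp add: partial_deriv_def [abs_def]\<close>)
qed

lemma Ck_mult: "Ck m f \<Longrightarrow> Ck m g \<Longrightarrow> Ck m (\<lambda>x. f x * g x)"
proof (induction m arbitrary: f g)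
  case 0
  then show ?case by (auto intro!: continuous_intros)
next
  case (Suc m)
  have "Ck m f" "Ck m g" using Suc.prems by (auto dest: Ck_SucD simp del: Ck.simps)
  moreover have "Ck m (partial_deriv i f)" "Ck m (partial_deriv i g)" for i
    using Suc.prems by auto
  ultimately show ?case
    by (intro Ck_SucI[OF has_derivative_mult[OF Suc.prems[THEN Ck_Suc_differentiable]]])
       (use Suc.IH in \<open>simp add: partial_deriv_def [abs_def] Ck_add\<close>)
qed

lemma Ck_inverse: "Ck m f \<Longrightarrow> (\<And>x. f x \<noteq> 0) \<Longrightarrow> Ck m (\<lambda>x. inverse (f x))"
proof (induction m arbitrary: f)
  case 0
  then show ?case by (auto intro!: continuous_intros)
next
  case (Suc m)
  have *: "Ck m f" using Suc.prems by (auto dest: Ck_SucD simp del: Ck.simps)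
  have d: "Ck m (partial_deriv i f)" for i
    using Suc.prems by auto
  show ?case
  proof (rule Ck_SucI[OF Deriv.has_derivative_inverse[OF Suc.prems(2) Ck_Suc_differentiable[OF Suc.prems(1)]]])
    fix i
    \<comment> \<open>The derivative of \<open>1/f\<close> is \<open>-f'/f^2\<close>: both factors
      \<open>1/f\<close> come from the induction hypothesis, and the sign is a constant factor so
      that \<open>Ck_mult\<close> applies.\<close>
    have "Ck m (\<lambda>x. (-1) * (inverse (f x) * partial_deriv i f x * inverse (f x)))"
      by (intro Ck_mult Ck_const Suc.IH * d Suc.prems)
    then show "Ck m (\<lambda>x. - (inverse (f x) * frechet_derivative f (at x) (axis i 1) * inverse (f x)))"
      by (simp add: partial_deriv_def)
  qed
qed

lemma Ck_sum: "finite I \<Longrightarrow> (\<And>i. i \<in> I \<Longrightarrow> Ck m (f i)) \<Longrightarrow> Ck m (\<lambda>x. \<Sum>i\<in>I. f i x)"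
  by (induction I rule: finite_induct) (auto intro: Ck_add Ck_const)

lemma test_fun_has_derivative:
  "test_fun \<Omega> \<phi> \<Longrightarrow> (\<phi> has_derivative frechet_derivative \<phi> (at x)) (at x)"
  unfolding test_fun_def smooth_fun_def by (metis Ck_Suc_differentiable)

lemma test_fun_continuous: "test_fun \<Omega> \<phi> \<Longrightarrow> continuous_on UNIV \<phi>"
  unfolding test_fun_def smooth_fun_def by (metis Ck_continuous)

lemma test_fun_partial_continuous: "test_fun \<Omega> \<phi> \<Longrightarrow> continuous_on UNIV (partial_deriv i \<phi>)"
  unfolding test_fun_def smooth_fun_def by (metis Ck.simps)

lemma test_fun_eq_0: "test_fun \<Omega> \<phi> \<Longrightarrow> x \<notin> \<Omega> \<Longrightarrow> \<phi> x = 0"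
  unfolding test_fun_def using closure_subset[of "{x. \<phi> x \<noteq> 0}"] by auto

text \<open>Off its closed support \<open>\<phi>\<close> vanishes on a whole neighbourhood, hence so
  does its derivative. Together with \<open>test_fun_eq_0\<close> this turns integrals over the
  whole space into integrals over \<open>\<Omega>\<close>.\<close>

lemma test_fun_partial_eq_0:
  assumes "test_fun \<Omega> \<phi>" "x \<notin> \<Omega>"
  shows "partial_deriv i \<phi> x = 0"
proof -
  let ?S = "- closure {x. \<phi> x \<noteq> 0}"
  have "x \<in> ?S" using assms by (auto simp: test_fun_def)
  have "(\<phi> has_derivative (\<lambda>h. 0)) (at x)"
  proof (rule has_derivative_transform_within_open[of "\<lambda>x. 0" _ _ _ ?S])
    show "0 = \<phi> y" if "y \<in> ?S" for y
      using that closure_subset[of "{x. \<phi> x \<noteq> 0}"] by auto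
  qed (use \<open>x \<in> ?S\<close> in auto)
  then show ?thesis by (simp add: has_derivative_imp_partial_deriv)
qed

section \<open>The truncated kinetic energy of a test field\<close>

lemma norm_vec_sq: "(norm (x :: real^'d))\<^sup>2 = (\<Sum>j\<in>UNIV. x $ j * x $ j)"
  by (simp add: dot_square_norm[symmetric] inner_vec_def)

text \<open>One factor encodes both the truncation and its derivative:
  \<open>(1 - cutoff \<delta> v) / (2 * \<delta>)\<close> is a bounded substitute for |v|^2/2, and
  its gradient in \<open>v\<close> is the square of the factor times \<open>v\<close>. The factor
  tends to 1 as \<open>\<delta>\<close> tends to 0.\<close>

definition cutoff :: "real \<Rightarrow> (real^'d::finite) \<Rightarrow> real" where
  "cutoff \<delta> v = inverse (1 + \<delta> * (norm v)\<^sup>2)"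

lemma cutoff_arg_pos: "0 < \<delta> \<Longrightarrow> 0 < 1 + \<delta> * (norm v)\<^sup>2"
  by (simp add: add_pos_nonneg)

text \<open>\<open>T\<close> is a rational function of the components with a nowhere vanishing
  denominator, hence smooth. It is zero wherever \<open>\<phi>\<close> is, so its support lies in
  the finite union of the supports of the components. The second claim is the chain rule.\<close>

lemma smooth_truncated_energy:
  assumes "\<And>j. test_fun \<Omega> (\<lambda>x. \<phi> x $ j)" and "0 < \<delta>"
  defines "T \<equiv> \<lambda>x. 1 / (2 * \<delta>) * (1 - cutoff \<delta> (\<phi> x))"
  shows "test_fun \<Omega> T"
    and "partial_deriv i T x = (cutoff \<delta> (\<phi> x))\<^sup>2 * (\<Sum>j\<in>UNIV. \<phi> x $ j * cgrad \<phi> x $ j $ i)"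
proof -
  have pos: "1 + \<delta> * (\<Sum>j\<in>UNIV. \<phi> x $ j * \<phi> x $ j) \<noteq> 0" for x
    using cutoff_arg_pos[OF assms(2), of "\<phi> x"] by (simp add: norm_vec_sq)
  have T: "T = (\<lambda>x. 1 / (2 * \<delta>) * (1 + (-1) * inverse (1 + \<delta> * (\<Sum>j\<in>UNIV. \<phi> x $ j * \<phi> x $ j))))"
    by (simp add: T_def cutoff_def norm_vec_sq)
  have "Ck m T" for m
    unfolding T
    by (intro Ck_mult Ck_add Ck_const Ck_inverse Ck_sum pos)
       (use assms(1) in \<open>auto simp: test_fun_def smooth_fun_def\<close>)
  moreover have "{x. T x \<noteq> 0} \<subseteq> (\<Union>j. closure {x. \<phi> x $ j \<noteq> 0})"
  proof
    fix x assume "x \<in> {x. T x \<noteq> 0}"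
    then have "\<phi> x \<noteq> 0" by (auto simp: T_def cutoff_def)
    then obtain j where "\<phi> x $ j \<noteq> 0" by (auto simp: vec_eq_iff)
    then show "x \<in> (\<Union>j. closure {x. \<phi> x $ j \<noteq> 0})"
      using closure_subset[of "{x. \<phi> x $ j \<noteq> 0}"] by auto
  qed
  then have cl: "closure {x. T x \<noteq> 0} \<subseteq> (\<Union>j. closure {x. \<phi> x $ j \<noteq> 0})"
    by (intro closure_minimal) auto
  moreover have "compact (\<Union>j. closure {x. \<phi> x $ j \<noteq> 0})"
    using assms(1) by (intro compact_UN) (auto simp: test_fun_def)
  then have "compact (closure {x. T x \<noteq> 0})"
    using cl by (metis closed_closure compact_Int_closed inf.absorb_iff2)
  ultimately show "test_fun \<Omega> T"
    using assms(1) unfolding test_fun_def smooth_fun_def by blast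
  have d: "((\<lambda>x. \<phi> x $ j) has_derivative frechet_derivative (\<lambda>x. \<phi> x $ j) (at x)) (at x)" for j
    using test_fun_has_derivative[OF assms(1)] .
  \<comment> \<open>The quotient keeps the shape produced by the differentiation rules; the 2 from
    the squares and the inner \<open>\<delta>\<close> cancel the prefactor afterwards.\<close>
  have "partial_deriv i T x = 1 / (2 * \<delta>) * (inverse (1 + \<delta> * (\<Sum>j\<in>UNIV. \<phi> x $ j * \<phi> x $ j)) *
      (\<delta> * (\<Sum>j\<in>UNIV. 2 * (\<phi> x $ j * cgrad \<phi> x $ j $ i))) *
      inverse (1 + \<delta> * (\<Sum>j\<in>UNIV. \<phi> x $ j * \<phi> x $ j)))"
    unfolding T
    apply (rule trans[OF has_derivative_imp_partial_deriv])
     apply (rule derivative_eq_intros refl d pos)+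
    apply (simp add: cgrad_def partial_deriv_def mult.commute)
    done
  then show "partial_deriv i T x = (cutoff \<delta> (\<phi> x))\<^sup>2 * (\<Sum>j\<in>UNIV. \<phi> x $ j * cgrad \<phi> x $ j $ i)"
    using assms(2)
    unfolding cutoff_def norm_vec_sq sum_distrib_left[symmetric] power2_eq_square[of "inverse _"]
    by simp
qed

subsection \<open>Ladyzhenskaya's inequality\<close>

text \<open>The fundamental theorem of calculus for h^2, started at a point where \<open>h\<close>
  vanishes. After taking absolute values the integral of 2hh' may be extended to the whole line; as
  a nonnegative integral it raises no question of integrability.\<close>

lemma square_le_nn_integral_deriv:
  fixes h h' :: "real \<Rightarrow> real"
  assumes d: "\<And>t. (h has_real_derivative h' t) (at t)"
    and c: "continuous_on UNIV h'"
    and z: "\<And>t. t < a \<Longrightarrow> h t = 0"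
  shows "ennreal ((h t)\<^sup>2) \<le> (\<integral>\<^sup>+s. ennreal (2 * \<bar>h s * h' s\<bar>) \<partial>lborel)"
proof -
  \<comment> \<open>A starting point at most \<open>t\<close> and strictly left of \<open>a\<close>,
    also when \<open>t\<close> itself lies left of \<open>a\<close>.\<close>
  define b where "b = min t (a - 1)"
  have hb: "h b = 0" "b \<le> t" by (auto simp: b_def z)
  have ch: "continuous_on UNIV h"
    using d by (meson DERIV_continuous_on)
  let ?g = "\<lambda>s. 2 * (h s * h' s)"
  have "(?g has_integral ((h t)\<^sup>2 - (h b)\<^sup>2)) {b..t}"
  proof (rule fundamental_theorem_of_calculus[OF hb(2)])
    fix s
    have "((\<lambda>s. (h s)\<^sup>2) has_real_derivative ?g s) (at s within {b..t})"
      by (rule derivative_eq_intros DERIV_subset[OF d] refl)+ auto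
    then show "((\<lambda>s. (h s)\<^sup>2) has_vector_derivative ?g s) (at s within {b..t})"
      by (simp add: has_real_derivative_iff_has_vector_derivative)
  qed
  then have g: "(?g has_integral (h t)\<^sup>2) {b..t}" by (simp add: hb)
  have "(\<lambda>s. \<bar>?g s\<bar>) integrable_on {b..t}"
    by (intro integrable_continuous_real continuous_intros)
       (auto intro: continuous_on_subset[OF ch] continuous_on_subset[OF c])
  then have ag: "((\<lambda>s. \<bar>?g s\<bar>) has_integral integral {b..t} (\<lambda>s. \<bar>?g s\<bar>)) {b..t}"
    by (rule integrable_integral)
  have "(h t)\<^sup>2 \<le> integral {b..t} (\<lambda>s. \<bar>?g s\<bar>)"
    by (rule has_integral_le[OF g ag]) simp
  then have "ennreal ((h t)\<^sup>2) \<le> ennreal (integral {b..t} (\<lambda>s. \<bar>?g s\<bar>))"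
    by (rule ennreal_leI)
  also have "\<dots> = (\<integral>\<^sup>+s. ennreal \<bar>?g s\<bar> * indicator {b..t} s \<partial>lborel)"
    by (rule nn_integral_has_integral_lebesgue'[symmetric, OF _ ag]) simp
  also have "\<dots> \<le> (\<integral>\<^sup>+s. ennreal (2 * \<bar>h s * h' s\<bar>) \<partial>lborel)"
    by (intro nn_integral_mono) (auto simp: indicator_def abs_mult)
  finally show ?thesis .
qed

section \<open>Iterated integrals and slicing in the plane and in space\<close>

lemma nn_integral_lborel_pair:
  fixes f :: "'a::euclidean_space \<times> 'b::euclidean_space \<Rightarrow> ennreal"
  assumes [measurable]: "f \<in> borel_measurable borel"
  shows "(\<integral>\<^sup>+x. \<integral>\<^sup>+y. f (x, y) \<partial>lborel \<partial>lborel) = (\<integral>\<^sup>+z. f z \<partial>lborel)"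
    and "(\<integral>\<^sup>+y. \<integral>\<^sup>+x. f (x, y) \<partial>lborel \<partial>lborel) = (\<integral>\<^sup>+z. f z \<partial>lborel)"
proof -
  have f: "f \<in> borel_measurable (lborel \<Otimes>\<^sub>M lborel)" by (simp add: lborel_prod)
  show "(\<integral>\<^sup>+x. \<integral>\<^sup>+y. f (x, y) \<partial>lborel \<partial>lborel) = (\<integral>\<^sup>+z. f z \<partial>lborel)"
    using lborel.nn_integral_fst[OF f] by (simp add: lborel_prod)
  show "(\<integral>\<^sup>+y. \<integral>\<^sup>+x. f (x, y) \<partial>lborel \<partial>lborel) = (\<integral>\<^sup>+z. f z \<partial>lborel)"
    using lborel_pair.nn_integral_snd[OF f] by (simp add: lborel_prod)
qed

lemma borel_measurable_nn_integral_lborel: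
  fixes f :: "'a::euclidean_space \<times> 'b::euclidean_space \<Rightarrow> ennreal"
  assumes "f \<in> borel_measurable borel"
  shows "(\<lambda>x. \<integral>\<^sup>+y. f (x, y) \<partial>lborel) \<in> borel_measurable borel"
    and "(\<lambda>y. \<integral>\<^sup>+x. f (x, y) \<partial>lborel) \<in> borel_measurable borel"
proof -
  have f: "f \<in> borel_measurable (lborel \<Otimes>\<^sub>M lborel)" using assms by (simp add: lborel_prod)
  show "(\<lambda>x. \<integral>\<^sup>+y. f (x, y) \<partial>lborel) \<in> borel_measurable borel"
    using lborel.borel_measurable_nn_integral_fst[OF f] by simp
  show "(\<lambda>y. \<integral>\<^sup>+x. f (x, y) \<partial>lborel) \<in> borel_measurable borel"
    using lborel.borel_measurable_nn_integral_fst[OF measurable_pair_swap[OF f]] by simp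
qed

text \<open>One factor of g^2 is bounded by a function of \<open>x\<close> alone and the other by a
  function of \<open>y\<close> alone, so the double integral of the bound splits into a product.
  This is the argument of Gagliardo and Nirenberg.\<close>

lemma nn_integral_square_le_planar:
  fixes g a b :: "real \<times> real \<Rightarrow> ennreal"
  assumes [measurable]: "a \<in> borel_measurable borel" "b \<in> borel_measurable borel"
    and ga: "\<And>x y. g (x, y) \<le> (\<integral>\<^sup>+s. a (s, y) \<partial>lborel)"
    and gb: "\<And>x y. g (x, y) \<le> (\<integral>\<^sup>+t. b (x, t) \<partial>lborel)"
    and [measurable]: "g \<in> borel_measurable borel"
  shows "(\<integral>\<^sup>+z. (g z)\<^sup>2 \<partial>lborel) \<le> (\<integral>\<^sup>+z. a z \<partial>lborel) * (\<integral>\<^sup>+z. b z \<partial>lborel)"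
proof -
  define A where "A y = (\<integral>\<^sup>+s. a (s, y) \<partial>lborel)" for y
  define B where "B x = (\<integral>\<^sup>+t. b (x, t) \<partial>lborel)" for x
  have [measurable]: "A \<in> borel_measurable borel" "B \<in> borel_measurable borel"
    unfolding A_def[abs_def] B_def[abs_def] by (intro borel_measurable_nn_integral_lborel assms)+
  have "(\<integral>\<^sup>+z. (g z)\<^sup>2 \<partial>lborel) = (\<integral>\<^sup>+x. \<integral>\<^sup>+y. (g (x, y))\<^sup>2 \<partial>lborel \<partial>lborel)"
    by (rule nn_integral_lborel_pair(1)[symmetric]) simp
  also have "\<dots> \<le> (\<integral>\<^sup>+x. \<integral>\<^sup>+y. B x * A y \<partial>lborel \<partial>lborel)"
    using ga gb by (intro nn_integral_mono) (auto simp: power2_eq_square A_def B_def intro!: mult_mono)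
  also have "\<dots> = (\<integral>\<^sup>+x. B x \<partial>lborel) * (\<integral>\<^sup>+y. A y \<partial>lborel)"
    by (simp add: nn_integral_cmult nn_integral_multc)
  also have "\<dots> = (\<integral>\<^sup>+z. a z \<partial>lborel) * (\<integral>\<^sup>+z. b z \<partial>lborel)"
    unfolding A_def B_def by (simp add: nn_integral_lborel_pair mult.commute)
  finally show ?thesis .
qed

lemma ennreal_two_abs_mult_le: "ennreal (2 * \<bar>x * y\<bar>) \<le> ennreal (x\<^sup>2 + y\<^sup>2)"
proof (rule ennreal_leI)
  have "0 \<le> (\<bar>x\<bar> - \<bar>y\<bar>)\<^sup>2" by simp
  then show "2 * \<bar>x * y\<bar> \<le> x\<^sup>2 + y\<^sup>2" by (simp add: power2_diff abs_mult)
qed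

text \<open>The preceding lemma with \<open>g\<close> the square of \<open>f\<close>. The line
  inequalities are hypotheses, with \<open>fx\<close> and \<open>fy\<close> arbitrary functions, so
  that the result applies equally to a plane and to slices of space.\<close>

lemma Ladyzhenskaya_planar:
  fixes f fx fy :: "real \<times> real \<Rightarrow> real"
  assumes [measurable]: "f \<in> borel_measurable borel" "fx \<in> borel_measurable borel" "fy \<in> borel_measurable borel"
    and "\<And>x y. ennreal ((f (x, y))\<^sup>2) \<le> (\<integral>\<^sup>+s. ennreal (2 * \<bar>f (s, y) * fx (s, y)\<bar>) \<partial>lborel)"
    and "\<And>x y. ennreal ((f (x, y))\<^sup>2) \<le> (\<integral>\<^sup>+t. ennreal (2 * \<bar>f (x, t) * fy (x, t)\<bar>) \<partial>lborel)"
  shows "(\<integral>\<^sup>+z. ennreal ((f z)^4) \<partial>lborel) \<le>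
    (\<integral>\<^sup>+z. ennreal (2 * \<bar>f z * fx z\<bar>) \<partial>lborel) * (\<integral>\<^sup>+z. ennreal (2 * \<bar>f z * fy z\<bar>) \<partial>lborel)"
proof -
  have "(\<integral>\<^sup>+z. ennreal ((f z)^4) \<partial>lborel) = (\<integral>\<^sup>+z. (ennreal ((f z)\<^sup>2))\<^sup>2 \<partial>lborel)"
    by (simp add: ennreal_power flip: power_mult)
  also have "\<dots> \<le> (\<integral>\<^sup>+z. ennreal (2 * \<bar>f z * fx z\<bar>) \<partial>lborel) * (\<integral>\<^sup>+z. ennreal (2 * \<bar>f z * fy z\<bar>) \<partial>lborel)"
    by (rule nn_integral_square_le_planar) (use assms in auto)
  finally show ?thesis .
qed

text \<open>Stated for squares, so that no square root of an extended nonnegative number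
  occurs.\<close>

lemma Cauchy_Schwarz_two_abs_mult:
  fixes f g :: "'a \<Rightarrow> real"
  assumes [measurable]: "f \<in> borel_measurable M" "g \<in> borel_measurable M"
  shows "(\<integral>\<^sup>+x. ennreal (2 * \<bar>f x * g x\<bar>) \<partial>M)\<^sup>2
    \<le> 4 * (\<integral>\<^sup>+x. ennreal ((f x)\<^sup>2) \<partial>M) * (\<integral>\<^sup>+x. ennreal ((g x)\<^sup>2) \<partial>M)"
proof -
  have "(\<integral>\<^sup>+x. ennreal (2 * \<bar>f x * g x\<bar>) \<partial>M) = 2 * (\<integral>\<^sup>+x. ennreal \<bar>f x\<bar> * ennreal \<bar>g x\<bar> \<partial>M)"
    by (subst nn_integral_cmult[symmetric]) (auto simp: ennreal_mult abs_mult intro!: nn_integral_cong)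
  then show ?thesis
    using Cauchy_Schwarz_nn_integral[of "\<lambda>x. ennreal \<bar>f x\<bar>" M "\<lambda>x. ennreal \<bar>g x\<bar>"]
    by (auto simp: ennreal_power power_mult_distrib mult.assoc intro!: mult_left_mono)
qed

text \<open>The inequality 2ab <= a^2 + b^2 combines two squared Cauchy-Schwarz bounds that share
  the mass \<open>m\<close>; the finite factor 2 is then cancelled in the extended reals.\<close>

lemma ennreal_mult_le_of_squares:
  fixes a b m g h :: ennreal
  assumes "a\<^sup>2 \<le> 4 * m * g" "b\<^sup>2 \<le> 4 * m * h"
  shows "a * b \<le> 2 * (m * (g + h))"
proof -
  have "2 * (a * b) \<le> a\<^sup>2 + b\<^sup>2"
    using sum_of_squares_ge_ennreal[of a b] by (simp add: mult.assoc)
  also have "\<dots> \<le> 4 * m * g + 4 * m * h" by (intro add_mono assms)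
  also have "\<dots> = 2 * (2 * (m * (g + h)))" by (simp add: algebra_simps)
  finally show ?thesis
    using ennreal_mult_le_mult_iff[of 2 "a * b" "2 * (m * (g + h))"] by simp
qed

text \<open>
  The planar inequality is applied on the slices \<open>z = const\<close>, whose mass \<open>\<integral> f(z, \<cdot>)\<^sup>2\<close> is bounded uniformly
  in \<open>z\<close> by means of the \<open>z\<close>-derivative.
\<close>

lemma Ladyzhenskaya_spatial:
  fixes f fx fy fz :: "real \<times> real \<times> real \<Rightarrow> real"
  assumes [measurable]: "f \<in> borel_measurable borel" "fx \<in> borel_measurable borel"
      "fy \<in> borel_measurable borel" "fz \<in> borel_measurable borel"
    and fz: "\<And>z x y. ennreal ((f (z, x, y))\<^sup>2) \<le> (\<integral>\<^sup>+r. ennreal (2 * \<bar>f (r, x, y) * fz (r, x, y)\<bar>) \<partial>lborel)"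
    and fx: "\<And>z x y. ennreal ((f (z, x, y))\<^sup>2) \<le> (\<integral>\<^sup>+s. ennreal (2 * \<bar>f (z, s, y) * fx (z, s, y)\<bar>) \<partial>lborel)"
    and fy: "\<And>z x y. ennreal ((f (z, x, y))\<^sup>2) \<le> (\<integral>\<^sup>+t. ennreal (2 * \<bar>f (z, x, t) * fy (z, x, t)\<bar>) \<partial>lborel)"
  shows "(\<integral>\<^sup>+v. ennreal ((f v)^4) \<partial>lborel) \<le>
    2 * ((\<integral>\<^sup>+v. ennreal ((f v)\<^sup>2 + (fz v)\<^sup>2) \<partial>lborel) * (\<integral>\<^sup>+v. ennreal ((fx v)\<^sup>2 + (fy v)\<^sup>2) \<partial>lborel))"
proof -
  have [measurable]: "(\<lambda>v. g (z, v)) \<in> borel_measurable borel"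
    if "g \<in> borel_measurable borel" for z and g :: "real \<times> real \<times> real \<Rightarrow> real"
    using that by (intro measurable_compose[OF _ that] borel_measurable_continuous_onI continuous_intros)
  define m where "m z = (\<integral>\<^sup>+v. ennreal ((f (z, v))\<^sup>2) \<partial>lborel)" for z
  define c where "c = (\<integral>\<^sup>+v. ennreal ((f v)\<^sup>2 + (fz v)\<^sup>2) \<partial>lborel)"
  have m: "m z \<le> c" for z
  proof -
    have "m z \<le> (\<integral>\<^sup>+v. \<integral>\<^sup>+r. ennreal (2 * \<bar>f (r, v) * fz (r, v)\<bar>) \<partial>lborel \<partial>lborel)"
      unfolding m_def using fz by (intro nn_integral_mono) auto
    also have "\<dots> = (\<integral>\<^sup>+v. ennreal (2 * \<bar>f v * fz v\<bar>) \<partial>lborel)"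
      by (rule nn_integral_lborel_pair(2)) simp
    also have "\<dots> \<le> c"
      unfolding c_def by (intro nn_integral_mono ennreal_two_abs_mult_le)
    finally show ?thesis .
  qed
  have slice: "(\<integral>\<^sup>+v. ennreal ((f (z, v))^4) \<partial>lborel) \<le>
      (2 * c) * (\<integral>\<^sup>+v. ennreal ((fx (z, v))\<^sup>2 + (fy (z, v))\<^sup>2) \<partial>lborel)" for z
  proof -
    let ?g = "\<integral>\<^sup>+v. ennreal ((fx (z, v))\<^sup>2) \<partial>lborel"
    let ?h = "\<integral>\<^sup>+v. ennreal ((fy (z, v))\<^sup>2) \<partial>lborel"
    have "(\<integral>\<^sup>+v. ennreal ((f (z, v))^4) \<partial>lborel) \<le>
      (\<integral>\<^sup>+v. ennreal (2 * \<bar>f (z, v) * fx (z, v)\<bar>) \<partial>lborel) *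
      (\<integral>\<^sup>+v. ennreal (2 * \<bar>f (z, v) * fy (z, v)\<bar>) \<partial>lborel)"
      by (rule Ladyzhenskaya_planar) (use fx fy in auto)
    also have "\<dots> \<le> 2 * (m z * (?g + ?h))"
      unfolding m_def by (intro ennreal_mult_le_of_squares Cauchy_Schwarz_two_abs_mult) auto
    also have "\<dots> \<le> 2 * (c * (?g + ?h))"
      by (intro mult_left_mono mult_right_mono m) auto
    also have "?g + ?h = (\<integral>\<^sup>+v. ennreal ((fx (z, v))\<^sup>2 + (fy (z, v))\<^sup>2) \<partial>lborel)"
      by (subst nn_integral_add[symmetric]) auto
    finally show ?thesis by (simp add: mult.assoc)
  qed
  have "(\<integral>\<^sup>+v. ennreal ((f v)^4) \<partial>lborel) = (\<integral>\<^sup>+z. \<integral>\<^sup>+v. ennreal ((f (z, v))^4) \<partial>lborel \<partial>lborel)"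
    by (rule nn_integral_lborel_pair(1)[symmetric]) simp
  also have "\<dots> \<le> (\<integral>\<^sup>+z. (2 * c) * (\<integral>\<^sup>+v. ennreal ((fx (z, v))\<^sup>2 + (fy (z, v))\<^sup>2) \<partial>lborel) \<partial>lborel)"
    by (intro nn_integral_mono slice)
  also have "\<dots> = (2 * c) * (\<integral>\<^sup>+z. \<integral>\<^sup>+v. ennreal ((fx (z, v))\<^sup>2 + (fy (z, v))\<^sup>2) \<partial>lborel \<partial>lborel)"
    by (rule nn_integral_cmult) (simp add: borel_measurable_nn_integral_lborel(1)[of "\<lambda>v. ennreal ((fx v)\<^sup>2 + (fy v)\<^sup>2)"])
  also have "\<dots> = (2 * c) * (\<integral>\<^sup>+v. ennreal ((fx v)\<^sup>2 + (fy v)\<^sup>2) \<partial>lborel)"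
    by (subst nn_integral_lborel_pair(1)[of "\<lambda>v. ennreal ((fx v)\<^sup>2 + (fy v)\<^sup>2)"]) auto
  finally show ?thesis by (simp add: c_def mult.assoc)
qed

section \<open>Coordinates in dimensions two and three\<close>

definition vec2 :: "'d::finite \<Rightarrow> real \<times> real \<Rightarrow> real^'d" where
  "vec2 i v = (\<chi> l. if l = i then fst v else snd v)"

text \<open>The index type has no preferred enumeration, so the positions of the leading coordinates
  are parameters and the last coordinate goes to every remaining index. When exactly one index
  remains, \<open>vec3\<close> is a coordinate isomorphism; the same holds for
  \<open>vec2\<close>.\<close>

definition vec3 :: "'d::finite \<Rightarrow> 'd \<Rightarrow> real \<times> real \<times> real \<Rightarrow> real^'d" where
  "vec3 k i v = (\<chi> l. if l = k then fst v else if l = i then fst (snd v) else snd (snd v))"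

lemma vec_borel_measurable:
  fixes f :: "'a \<Rightarrow> 'd::finite \<Rightarrow> real"
  assumes "\<And>l. (\<lambda>v. f v l) \<in> borel_measurable M"
  shows "(\<lambda>v. \<chi> l. f v l) \<in> borel_measurable M"
  unfolding borel_measurable_euclidean_space[where 'c = "real^'d"]
  using assms by (auto simp: Basis_vec_def inner_axis)

lemma vec2_borel_measurable: "vec2 i \<in> borel_measurable borel"
  unfolding vec2_def
proof (rule vec_borel_measurable)
  show "(\<lambda>v. if l = i then fst v else snd v) \<in> borel_measurable borel" for l
    by (cases "l = i") (auto intro!: borel_measurable_continuous_onI continuous_intros)
qed

lemma vec3_borel_measurable: "vec3 k i \<in> borel_measurable borel"
  unfolding vec3_def
proof (rule vec_borel_measurable)
  show "(\<lambda>v. if l = k then fst v else if l = i then fst (snd v) else snd (snd v)) \<in> borel_measurable borel" for l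
    by (cases "l = k"; cases "l = i") (auto intro!: borel_measurable_continuous_onI continuous_intros)
qed

lemma emeasure_lborel_Times:
  fixes A :: "'a::euclidean_space set" and B :: "'b::euclidean_space set"
  assumes "A \<in> sets borel" "B \<in> sets borel"
  shows "emeasure lborel (A \<times> B) = emeasure lborel A * emeasure lborel B"
  using lborel.emeasure_pair_measure_Times[of A lborel B] assms by (simp add: lborel_prod)

text \<open>Lebesgue measure is determined by its values on boxes. The preimage of a box is a
  product of intervals, and the product of their lengths is the product over the basis once the
  latter is reindexed by the two indices.\<close>

lemma lborel_vec2:
  assumes "UNIV = {i, j :: 'd::finite}" "i \<noteq> j"
  shows "lborel = distr lborel borel (vec2 i :: _ \<Rightarrow> real^'d)"
proof (rule lborel_eqI)
  note vec2_borel_measurable[measurable]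
  fix l u :: "real^'d"
  assume lu: "\<And>b. b \<in> Basis \<Longrightarrow> l \<bullet> b \<le> u \<bullet> b"
  have le: "l $ n \<le> u $ n" for n
    using lu[of "axis n 1"] by (auto simp: Basis_vec_def inner_axis)
  have "vec2 i -` box l u = {l $ i<..<u $ i} \<times> {l $ j<..<u $ j}"
  proof -
    have all: "(\<forall>n. P n) = (P i \<and> P j)" for P
      using assms(1) by (metis UNIV_I insertE singletonD)
    show ?thesis
      using assms(2) by (auto simp: mem_box_cart all vec2_def)
  qed
  moreover have "(\<Prod>b\<in>Basis. (u - l) \<bullet> b) = (u $ i - l $ i) * (u $ j - l $ j)"
  proof -
    have "(\<Prod>b\<in>Basis. (u - l) \<bullet> b) = (\<Prod>n\<in>UNIV. u $ n - l $ n)"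
      by (simp add: Basis_vec_def inner_axis UNION_singleton_eq_range
          prod.reindex inj_on_def axis_eq_axis)
    then show ?thesis unfolding assms(1) using assms(2-) by simp
  qed
  moreover have "emeasure (distr lborel borel (vec2 i)) (box l u) = emeasure lborel (vec2 i -` box l u)"
    by (simp add: emeasure_distr)
  ultimately show "emeasure (distr lborel borel (vec2 i)) (box l u) = ennreal (\<Prod>b\<in>Basis. (u - l) \<bullet> b)"
    by (simp add: emeasure_lborel_Times borel_Times le ennreal_mult)
qed simp

lemma lborel_vec3:
  assumes "UNIV = {k, i, j :: 'd::finite}" "k \<noteq> i" "k \<noteq> j" "i \<noteq> j"
  shows "lborel = distr lborel borel (vec3 k i :: _ \<Rightarrow> real^'d)"
proof (rule lborel_eqI)
  note vec3_borel_measurable[measurable]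
  fix l u :: "real^'d"
  assume lu: "\<And>b. b \<in> Basis \<Longrightarrow> l \<bullet> b \<le> u \<bullet> b"
  have le: "l $ n \<le> u $ n" for n
    using lu[of "axis n 1"] by (auto simp: Basis_vec_def inner_axis)
  have "vec3 k i -` box l u = {l $ k<..<u $ k} \<times> {l $ i<..<u $ i} \<times> {l $ j<..<u $ j}"
  proof -
    have all: "(\<forall>n. P n) = (P k \<and> P i \<and> P j)" for P
      using assms(1) by (metis UNIV_I insertE singletonD)
    show ?thesis
      using assms(2-) by (auto simp: mem_box_cart all vec3_def)
  qed
  moreover have "(\<Prod>b\<in>Basis. (u - l) \<bullet> b) = (u $ k - l $ k) * ((u $ i - l $ i) * (u $ j - l $ j))"
  proof -
    have "(\<Prod>b\<in>Basis. (u - l) \<bullet> b) = (\<Prod>n\<in>UNIV. u $ n - l $ n)"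
      by (simp add: Basis_vec_def inner_axis UNION_singleton_eq_range
          prod.reindex inj_on_def axis_eq_axis)
    then show ?thesis unfolding assms(1) using assms(2-) by simp
  qed
  moreover have "emeasure (distr lborel borel (vec3 k i)) (box l u) = emeasure lborel (vec3 k i -` box l u)"
    by (simp add: emeasure_distr)
  ultimately show "emeasure (distr lborel borel (vec3 k i)) (box l u) = ennreal (\<Prod>b\<in>Basis. (u - l) \<bullet> b)"
    by (simp add: emeasure_lborel_Times borel_Times le ennreal_mult)
qed simp

text \<open>On a line in direction \<open>i\<close> the test function is a C^1 function of one
  variable whose derivative is the partial derivative, and bounded support makes it vanish far to
  the left.\<close>

lemma test_fun_square_le_line_integral:
  assumes "test_fun \<Omega> \<phi>"
  shows "ennreal ((\<phi> (c + t *\<^sub>R axis i 1))\<^sup>2) \<le>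
    (\<integral>\<^sup>+s. ennreal (2 * \<bar>\<phi> (c + s *\<^sub>R axis i 1) * partial_deriv i \<phi> (c + s *\<^sub>R axis i 1)\<bar>) \<partial>lborel)"
proof -
  let ?c = "\<lambda>s. c + s *\<^sub>R axis i 1"
  have d: "((\<lambda>s. \<phi> (?c s)) has_real_derivative partial_deriv i \<phi> (?c s)) (at s)" for s
  proof -
    have "((\<lambda>s. \<phi> (?c s)) has_derivative (\<lambda>h. frechet_derivative \<phi> (at (?c s)) (h *\<^sub>R axis i 1))) (at s)"
      by (rule has_derivative_compose[OF _ test_fun_has_derivative[OF assms]])
         (auto intro!: derivative_eq_intros)
    moreover have "linear (frechet_derivative \<phi> (at (?c s)))"
      using test_fun_has_derivative[OF assms] has_derivative_linear by blast
    ultimately show ?thesis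
      by (simp add: has_field_derivative_def partial_deriv_def linear_cmul mult.commute[of _ "frechet_derivative _ _ _"])
  qed
  have "bounded (closure {x. \<phi> x \<noteq> 0})"
    using assms by (simp add: test_fun_def compact_imp_bounded)
  then obtain B where B: "\<And>x. x \<in> closure {x. \<phi> x \<noteq> 0} \<Longrightarrow> norm x \<le> B"
    by (auto simp: bounded_iff)
  \<comment> \<open>Below this threshold the component \<open>i\<close> of the point is less than
    -|B|, so its norm exceeds \<open>B\<close>. The absolute value covers a negative
    \<open>B\<close>, which an empty support would allow.\<close>
  have "\<phi> (?c s) = 0" if "s < - \<bar>B\<bar> - \<bar>c $ i\<bar>" for s
  proof (rule ccontr)
    assume "\<phi> (?c s) \<noteq> 0"
    then have "norm (?c s) \<le> B"
      using closure_subset[of "{x. \<phi> x \<noteq> 0}"] by (intro B) auto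
    moreover have "\<bar>?c s $ i\<bar> \<le> norm (?c s)" by (rule component_le_norm_cart)
    ultimately show False using that by (auto simp: axis_def)
  qed
  then show ?thesis
    by (intro square_le_nn_integral_deriv[OF d])
       (auto intro!: continuous_on_compose2[OF test_fun_partial_continuous[OF assms]] continuous_intros)
qed

text \<open>Each integral in the planar or spatial inequality is dominated by the full H^1 energy,
  which puts both dimensions under one bound. It depends on the H^1 energy alone and can therefore
  pass to limits of test functions.\<close>

lemma test_fun_L4_bound:
  fixes \<phi> :: "real^'d::finite \<Rightarrow> real"
  assumes dim: "CARD('d) = 2 \<or> CARD('d) = 3" and \<phi>: "test_fun \<Omega> \<phi>"
  shows "(\<integral>\<^sup>+x. ennreal ((\<phi> x)^4) \<partial>lborel) \<le>
    2 * (\<integral>\<^sup>+x. ennreal ((\<phi> x)\<^sup>2 + (\<Sum>i\<in>UNIV. (partial_deriv i \<phi> x)\<^sup>2)) \<partial>lborel)\<^sup>2"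
    (is "_ \<le> 2 * ?E\<^sup>2")
proof -
  have [measurable]: "\<phi> \<in> borel_measurable borel" "partial_deriv i \<phi> \<in> borel_measurable borel" for i
    using \<phi> by (auto intro!: borel_measurable_continuous_onI test_fun_continuous test_fun_partial_continuous)
  have le: "(\<integral>\<^sup>+x. ennreal ((\<phi> x)\<^sup>2 + (partial_deriv i \<phi> x)\<^sup>2) \<partial>lborel) \<le> ?E" for i
    by (intro nn_integral_mono ennreal_leI add_left_mono member_le_sum) auto
  \<comment> \<open>Distinct indices ensure that the two terms are different summands of the full
    sum.\<close>
  have le2: "(\<integral>\<^sup>+x. ennreal ((partial_deriv i \<phi> x)\<^sup>2 + (partial_deriv j \<phi> x)\<^sup>2) \<partial>lborel) \<le> ?E"
    if "i \<noteq> j" for i j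
  proof (intro nn_integral_mono ennreal_leI)
    fix x
    have "(\<Sum>n\<in>{i,j}. (partial_deriv n \<phi> x)\<^sup>2) \<le> (\<Sum>n\<in>UNIV. (partial_deriv n \<phi> x)\<^sup>2)"
      by (intro sum_mono2) auto
    then show "(partial_deriv i \<phi> x)\<^sup>2 + (partial_deriv j \<phi> x)\<^sup>2 \<le>
        (\<phi> x)\<^sup>2 + (\<Sum>i\<in>UNIV. (partial_deriv i \<phi> x)\<^sup>2)"
      using that by (simp add: add_increasing)
  qed
  show ?thesis
    using dim
  proof
    assume "CARD('d) = 2"
    then obtain i j :: 'd where ij: "UNIV = {i, j}" "i \<noteq> j"
      by (auto simp: card_2_iff)
    note vec2_borel_measurable[measurable]
    have tr: "(\<integral>\<^sup>+x. ennreal (g x) \<partial>lborel) = (\<integral>\<^sup>+v. ennreal (g (vec2 i v)) \<partial>lborel)"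
      if [measurable]: "g \<in> borel_measurable borel" for g :: "real^'d \<Rightarrow> real"
      by (subst lborel_vec2[OF ij]) (simp add: nn_integral_distr)
    \<comment> \<open>Each identity splits off one coordinate, so that varying it traces a line in
      an axis direction, the form required by
      \<open>test_fun_square_le_line_integral\<close>.\<close>
    have e: "vec2 i (x, y) = vec2 i (0, y) + x *\<^sub>R axis i 1"
            "vec2 i (x, y) = vec2 i (x, 0) + y *\<^sub>R axis j 1" for x y
      using ij by (auto simp: vec2_def axis_def vec_eq_iff)
    have line: "ennreal ((\<phi> (vec2 i (x, y)))\<^sup>2) \<le> (\<integral>\<^sup>+s. ennreal (2 * \<bar>\<phi> (vec2 i (s, y)) * partial_deriv i \<phi> (vec2 i (s, y))\<bar>) \<partial>lborel)"
         "ennreal ((\<phi> (vec2 i (x, y)))\<^sup>2) \<le> (\<integral>\<^sup>+s. ennreal (2 * \<bar>\<phi> (vec2 i (x, s)) * partial_deriv j \<phi> (vec2 i (x, s))\<bar>) \<partial>lborel)"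
         for x y
      using test_fun_square_le_line_integral[OF \<phi>, of "vec2 i (0, y)" x i, folded e(1)]
        test_fun_square_le_line_integral[OF \<phi>, of "vec2 i (x, 0)" y j, folded e(2)] .
    have "(\<integral>\<^sup>+x. ennreal ((\<phi> x)^4) \<partial>lborel) \<le>
      (\<integral>\<^sup>+x. ennreal (2 * \<bar>\<phi> x * partial_deriv i \<phi> x\<bar>) \<partial>lborel) *
      (\<integral>\<^sup>+x. ennreal (2 * \<bar>\<phi> x * partial_deriv j \<phi> x\<bar>) \<partial>lborel)"
      by (subst tr, simp)+ (rule Ladyzhenskaya_planar[OF _ _ _ line], simp_all)
    also have "\<dots> \<le> ?E * ?E"
      by (rule mult_mono[OF order_trans[OF nn_integral_mono le] order_trans[OF nn_integral_mono le]])
         (rule ennreal_two_abs_mult_le | simp)+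
    \<comment> \<open>The factor 2 matches the constant of the spatial inequality.\<close>
    also have "\<dots> \<le> 2 * ?E\<^sup>2"
      using mult_right_mono[of 1 2 "?E * ?E"] by (simp add: power2_eq_square)
    finally show ?thesis .
  next
    assume "CARD('d) = 3"
    then obtain k i j :: 'd where kij: "UNIV = {k, i, j}" "k \<noteq> i" "k \<noteq> j" "i \<noteq> j"
      by (auto simp: card_3_iff)
    note vec3_borel_measurable[measurable]
    have tr: "(\<integral>\<^sup>+x. ennreal (g x) \<partial>lborel) = (\<integral>\<^sup>+v. ennreal (g (vec3 k i v)) \<partial>lborel)"
      if [measurable]: "g \<in> borel_measurable borel" for g :: "real^'d \<Rightarrow> real"
      by (subst lborel_vec3[OF kij]) (simp add: nn_integral_distr)
    have e: "vec3 k i (z, x, y) = vec3 k i (0, x, y) + z *\<^sub>R axis k 1"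
            "vec3 k i (z, x, y) = vec3 k i (z, 0, y) + x *\<^sub>R axis i 1"
            "vec3 k i (z, x, y) = vec3 k i (z, x, 0) + y *\<^sub>R axis j 1" for x y z
      using kij by (auto simp: vec3_def axis_def vec_eq_iff)
    have line: "ennreal ((\<phi> (vec3 k i (z, x, y)))\<^sup>2) \<le> (\<integral>\<^sup>+s. ennreal (2 * \<bar>\<phi> (vec3 k i (s, x, y)) * partial_deriv k \<phi> (vec3 k i (s, x, y))\<bar>) \<partial>lborel)"
         "ennreal ((\<phi> (vec3 k i (z, x, y)))\<^sup>2) \<le> (\<integral>\<^sup>+s. ennreal (2 * \<bar>\<phi> (vec3 k i (z, s, y)) * partial_deriv i \<phi> (vec3 k i (z, s, y))\<bar>) \<partial>lborel)"
         "ennreal ((\<phi> (vec3 k i (z, x, y)))\<^sup>2) \<le> (\<integral>\<^sup>+s. ennreal (2 * \<bar>\<phi> (vec3 k i (z, x, s)) * partial_deriv j \<phi> (vec3 k i (z, x, s))\<bar>) \<partial>lborel)"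
         for x y z
      using test_fun_square_le_line_integral[OF \<phi>, of "vec3 k i (0, x, y)" z k, folded e(1)]
        test_fun_square_le_line_integral[OF \<phi>, of "vec3 k i (z, 0, y)" x i, folded e(2)]
        test_fun_square_le_line_integral[OF \<phi>, of "vec3 k i (z, x, 0)" y j, folded e(3)] .
    have "(\<integral>\<^sup>+x. ennreal ((\<phi> x)^4) \<partial>lborel) \<le>
      2 * ((\<integral>\<^sup>+x. ennreal ((\<phi> x)\<^sup>2 + (partial_deriv k \<phi> x)\<^sup>2) \<partial>lborel) *
      (\<integral>\<^sup>+x. ennreal ((partial_deriv i \<phi> x)\<^sup>2 + (partial_deriv j \<phi> x)\<^sup>2) \<partial>lborel))"
      by (subst tr, simp)+ (rule Ladyzhenskaya_spatial[OF _ _ _ _ line], simp_all)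
    also have "\<dots> \<le> 2 * (?E * ?E)"
      by (intro mult_left_mono mult_mono le le2 kij) auto
    finally show ?thesis by (simp add: power2_eq_square)
  qed
qed

subsection \<open>Square integrable functions and Sobolev spaces\<close>

lemma borel_measurable_vec_nth:
  fixes f :: "'a \<Rightarrow> 'b::euclidean_space^'d::finite"
  assumes "f \<in> borel_measurable M"
  shows "(\<lambda>x. f x $ i) \<in> borel_measurable M"
  by (rule borel_measurable_continuous_on[OF _ assms]) (intro continuous_intros)

lemma borel_measurable_matrix_form:
  fixes A :: "'a \<Rightarrow> real^'d^'d::finite"
  assumes "A \<in> borel_measurable M" "w \<in> borel_measurable M" "v \<in> borel_measurable M"
  shows "(\<lambda>x. (A x *v w x) \<bullet> v x) \<in> borel_measurable M"
  unfolding inner_vec_def matrix_vector_mult_def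
  using assms by (auto intro!: borel_measurable_sum borel_measurable_times borel_measurable_vec_nth)

text \<open>The norm of this matrix type is the Frobenius norm, so Cauchy-Schwarz in each row gives
  the bound.\<close>

lemma norm_matrix_vector_mult_le:
  fixes A :: "real^'n^'m"
  shows "norm (A *v x) \<le> norm A * norm x"
proof -
  have "norm (A *v x) = L2_set (\<lambda>i. \<bar>A $ i \<bullet> x\<bar>) UNIV"
    by (simp add: norm_vec_def matrix_mult_dot)
  also have "\<dots> \<le> L2_set (\<lambda>i. norm (A $ i) * norm x) UNIV"
    by (intro L2_set_mono Cauchy_Schwarz_ineq2) auto
  also have "\<dots> = norm A * norm x"
    by (simp add: norm_vec_def[of A] L2_set_left_distrib)
  finally show ?thesis .
qed

lemma matrix_form_le: "\<bar>(A *v w) \<bullet> v\<bar> \<le> norm (A :: real^'d^'d) * norm w * norm v"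
  by (rule order_trans[OF Cauchy_Schwarz_ineq2 mult_right_mono[OF norm_matrix_vector_mult_le norm_ge_zero]])

lemma abs_trace_le: "\<bar>\<Sum>j\<in>UNIV. (A :: real^'d^'d) $ j $ j\<bar> \<le> CARD('d) * norm A"
proof -
  have "\<bar>A $ j $ j\<bar> \<le> norm A" for j
    using component_le_norm_cart[of "A $ j" j] Finite_Cartesian_Product.norm_nth_le[of A j] by linarith
  then have "(\<Sum>j\<in>UNIV. \<bar>A $ j $ j\<bar>) \<le> CARD('d) * norm A"
    by (intro order_trans[OF sum_bounded_above[where K = "norm A"]]) auto
  then show ?thesis by (rule order_trans[OF sum_abs])
qed

section \<open>Calculus of square integrable functions\<close>

lemma L2_measurable: "L2 \<Omega> f \<Longrightarrow> f \<in> borel_measurable (lebesgue_on \<Omega>)"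
  by (simp add: L2_def)

lemma L2_square_integrable: "L2 \<Omega> f \<Longrightarrow> integrable (lebesgue_on \<Omega>) (\<lambda>x. (norm (f x))\<^sup>2)"
  by (simp add: L2_def)

text \<open>The product of the norms is at most the sum of their squares, an integrable majorant.
  The pointwise hypothesis lets one lemma serve inner products, matrix forms and truncated
  integrands.\<close>

lemma L2_product_integrable:
  fixes h :: "_ \<Rightarrow> real"
  assumes "L2 \<Omega> f" "L2 \<Omega> g" "h \<in> borel_measurable (lebesgue_on \<Omega>)"
    and "\<And>x. \<bar>h x\<bar> \<le> C * (norm (f x) * norm (g x))"
  shows "integrable (lebesgue_on \<Omega>) h"
proof (rule Bochner_Integration.integrable_bound)
  show "integrable (lebesgue_on \<Omega>) (\<lambda>x. \<bar>C\<bar> * ((norm (f x))\<^sup>2 + (norm (g x))\<^sup>2))"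
    using assms by (auto simp: L2_def)
  have "\<bar>h x\<bar> \<le> \<bar>C\<bar> * ((norm (f x))\<^sup>2 + (norm (g x))\<^sup>2)" for x
  proof -
    have "norm (f x) * norm (g x) \<le> (norm (f x))\<^sup>2 + (norm (g x))\<^sup>2"
      using sum_squares_bound[of "norm (f x)" "norm (g x)"]
        mult_nonneg_nonneg[OF norm_ge_zero[of "f x"] norm_ge_zero[of "g x"]] by linarith
    then have "C * (norm (f x) * norm (g x)) \<le> \<bar>C\<bar> * ((norm (f x))\<^sup>2 + (norm (g x))\<^sup>2)"
      by (intro mult_mono) auto
    then show ?thesis using assms(4)[of x] by linarith
  qed
  then show "AE x in lebesgue_on \<Omega>. norm (h x) \<le> norm (\<bar>C\<bar> * ((norm (f x))\<^sup>2 + (norm (g x))\<^sup>2))"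
    by (auto intro!: AE_I2)
qed (fact assms)

lemma L2_inner_integrable: "L2 \<Omega> f \<Longrightarrow> L2 \<Omega> g \<Longrightarrow> integrable (lebesgue_on \<Omega>) (\<lambda>x. f x \<bullet> g x)"
  by (rule L2_product_integrable[where C = 1 and f = f and g = g])
     (auto simp: L2_def intro!: borel_measurable_inner Cauchy_Schwarz_ineq2)

lemma L2_of_bound:
  assumes "L2 \<Omega> f" "h \<in> borel_measurable (lebesgue_on \<Omega>)" "\<And>x. norm (h x) \<le> C * norm (f x)"
  shows "L2 \<Omega> h"
proof -
  have "integrable (lebesgue_on \<Omega>) (\<lambda>x. (norm (h x))\<^sup>2)"
  proof (rule L2_product_integrable[OF assms(1,1), where C = "C * C"])
    show "\<bar>(norm (h x))\<^sup>2\<bar> \<le> C * C * (norm (f x) * norm (f x))" for x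
      using mult_mono[OF assms(3)[of x] assms(3)[of x]] order_trans[OF norm_ge_zero assms(3)[of x]]
      by (simp add: power2_eq_square mult_ac)
  qed (use assms(2) in auto)
  then show ?thesis using assms by (simp add: L2_def)
qed

lemma L2_add:
  assumes "L2 \<Omega> f" "L2 \<Omega> g"
  shows "L2 \<Omega> (\<lambda>x. f x + g x)"
proof -
  have "integrable (lebesgue_on \<Omega>) (\<lambda>x. (norm (f x + g x))\<^sup>2)"
  proof (rule Bochner_Integration.integrable_bound)
    show "integrable (lebesgue_on \<Omega>) (\<lambda>x. 2 * (norm (f x))\<^sup>2 + 2 * (norm (g x))\<^sup>2)"
      using assms by (auto simp: L2_def)
    have "(norm (f x + g x))\<^sup>2 \<le> 2 * (norm (f x))\<^sup>2 + 2 * (norm (g x))\<^sup>2" for x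
    proof -
      have "(norm (f x + g x))\<^sup>2 \<le> (norm (f x) + norm (g x))\<^sup>2"
        by (intro power_mono norm_triangle_ineq) auto
      then show ?thesis
        using sum_squares_bound[of "norm (f x)" "norm (g x)"] by (simp add: power2_sum)
    qed
    then show "AE x in lebesgue_on \<Omega>. norm ((norm (f x + g x))\<^sup>2) \<le> norm (2 * (norm (f x))\<^sup>2 + 2 * (norm (g x))\<^sup>2)"
      by auto
  qed (use assms in \<open>auto simp: L2_def\<close>)
  then show ?thesis using assms by (auto simp: L2_def)
qed

lemma L2_scaleR: "L2 \<Omega> f \<Longrightarrow> L2 \<Omega> (\<lambda>x. c *\<^sub>R f x)"
  by (rule L2_of_bound[where C = "\<bar>c\<bar>" and f = f]) (auto simp: L2_def)

lemma L2_diff: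
  assumes "L2 \<Omega> f" "L2 \<Omega> g"
  shows "L2 \<Omega> (\<lambda>x. f x - g x)"
  using L2_add[OF assms(1) L2_scaleR[OF assms(2), of "-1"]] by simp

lemma L2_vec_nth:
  fixes f :: "_ \<Rightarrow> 'b::euclidean_space^'n::finite"
  shows "L2 \<Omega> f \<Longrightarrow> L2 \<Omega> (\<lambda>x. f x $ i)"
  by (rule L2_of_bound[where C = 1 and f = f])
     (auto simp: L2_def Finite_Cartesian_Product.norm_nth_le intro: borel_measurable_vec_nth)

lemma L2_trace:
  fixes G :: "_ \<Rightarrow> real^'d^'d::finite"
  assumes "L2 \<Omega> G"
  shows "L2 \<Omega> (\<lambda>x. \<Sum>j\<in>UNIV. G x $ j $ j)"
  by (rule L2_of_bound[OF assms, where C = "CARD('d)"])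
     (use L2_measurable[OF assms] abs_trace_le in
       \<open>auto intro!: borel_measurable_sum borel_measurable_vec_nth\<close>)

text \<open>A continuous function is bounded on the compact closure of \<open>\<Omega>\<close>, and
  \<open>\<Omega>\<close> has finite measure. Test functions and their derivatives may thus be
  paired with any square integrable function.\<close>

lemma L2_continuous:
  fixes f :: "real^'d::finite \<Rightarrow> 'b::euclidean_space"
  assumes "open \<Omega>" "bounded \<Omega>" "continuous_on UNIV f"
  shows "L2 \<Omega> f"
proof -
  interpret finite_measure "lebesgue_on \<Omega>"
    by (intro finite_measure_lebesgue_on lmeasurable_open assms)
  have "compact (closure \<Omega>)" using assms by simp
  then have "bounded (f ` closure \<Omega>)"
    using assms(3) by (intro compact_imp_bounded compact_continuous_image) (auto intro: continuous_on_subset)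
  then obtain B where B: "\<And>x. x \<in> closure \<Omega> \<Longrightarrow> norm (f x) \<le> B"
    by (auto simp: bounded_iff)
  have m: "f \<in> borel_measurable (lebesgue_on \<Omega>)"
    using assms by (intro continuous_imp_measurable_on_sets_lebesgue) (auto intro: continuous_on_subset)
  have "integrable (lebesgue_on \<Omega>) (\<lambda>x. (norm (f x))\<^sup>2)"
  proof (rule integrable_const_bound[where B = "B\<^sup>2"])
    show "AE x in lebesgue_on \<Omega>. norm ((norm (f x))\<^sup>2) \<le> B\<^sup>2"
      using B closure_subset[of \<Omega>] by (intro AE_I2) (auto intro!: power_mono)
  qed (use m in simp)
  then show ?thesis using m by (simp add: L2_def)
qed

section \<open>Weak gradients and approximation by test fields\<close>

lemma H1_Grad:
  assumes "H1 \<Omega> u"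
  shows "L2 \<Omega> u" "L2 \<Omega> (Grad \<Omega> u)" "weak_grad \<Omega> u (Grad \<Omega> u)"
  using assms someI_ex[of "\<lambda>G. L2 \<Omega> G \<and> weak_grad \<Omega> u G"] by (auto simp: H1_def Grad_def)

lemma H10_imp_H1: "H10 \<Omega> u \<Longrightarrow> H1 \<Omega> u"
  by (simp add: H10_def)

text \<open>Applied to the extrapolated velocity \<open>ustar\<close>. The same combination of the
  gradients is a weak gradient. Only membership is concluded, since the choice made by
  \<open>Grad\<close> is not linear by definition.\<close>

lemma H1_linear_combination:
  assumes "open \<Omega>" "bounded \<Omega>" "H1 \<Omega> u" "H1 \<Omega> v"
  shows "H1 \<Omega> (\<lambda>x. a *\<^sub>R u x + b *\<^sub>R v x)"
proof -
  note u = H1_Grad[OF assms(3)] and v = H1_Grad[OF assms(4)]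
  let ?G = "\<lambda>x. a *\<^sub>R Grad \<Omega> u x + b *\<^sub>R Grad \<Omega> v x"
  have "weak_grad \<Omega> (\<lambda>x. a *\<^sub>R u x + b *\<^sub>R v x) ?G"
    unfolding weak_grad_def
  proof (intro allI impI)
    fix j i \<phi> assume \<phi>: "test_fun \<Omega> \<phi>"
    have L: "L2 \<Omega> \<phi>" "L2 \<Omega> (partial_deriv i \<phi>)"
      using assms \<phi> by (auto intro!: L2_continuous test_fun_continuous test_fun_partial_continuous)
    have int: "integrable (lebesgue_on \<Omega>) (\<lambda>x. u x $ j * partial_deriv i \<phi> x)"
         "integrable (lebesgue_on \<Omega>) (\<lambda>x. v x $ j * partial_deriv i \<phi> x)"
         "integrable (lebesgue_on \<Omega>) (\<lambda>x. Grad \<Omega> u x $ j $ i * \<phi> x)"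
         "integrable (lebesgue_on \<Omega>) (\<lambda>x. Grad \<Omega> v x $ j $ i * \<phi> x)"
      using L2_inner_integrable[OF L2_vec_nth[OF u(1)] L(2)] L2_inner_integrable[OF L2_vec_nth[OF v(1)] L(2)]
        L2_inner_integrable[OF L2_vec_nth[OF L2_vec_nth[OF u(2)]] L(1)]
        L2_inner_integrable[OF L2_vec_nth[OF L2_vec_nth[OF v(2)]] L(1)] by auto
    have "omint \<Omega> (\<lambda>x. (a *\<^sub>R u x + b *\<^sub>R v x) $ j * partial_deriv i \<phi> x)
        = a * omint \<Omega> (\<lambda>x. u x $ j * partial_deriv i \<phi> x) + b * omint \<Omega> (\<lambda>x. v x $ j * partial_deriv i \<phi> x)"
      using int by (simp add: distrib_right mult.assoc)
    also have "\<dots> = - (a * omint \<Omega> (\<lambda>x. Grad \<Omega> u x $ j $ i * \<phi> x) + b * omint \<Omega> (\<lambda>x. Grad \<Omega> v x $ j $ i * \<phi> x))"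
      using u(3) v(3) \<phi> by (simp add: weak_grad_def)
    also have "\<dots> = - omint \<Omega> (\<lambda>x. ?G x $ j $ i * \<phi> x)"
      using int by (simp add: distrib_right mult.assoc)
    finally show "omint \<Omega> (\<lambda>x. (a *\<^sub>R u x + b *\<^sub>R v x) $ j * partial_deriv i \<phi> x)
        = - omint \<Omega> (\<lambda>x. ?G x $ j $ i * \<phi> x)" .
  qed
  moreover have "L2 \<Omega> (\<lambda>x. a *\<^sub>R u x + b *\<^sub>R v x)" "L2 \<Omega> ?G"
    using u v by (auto intro: L2_add L2_scaleR)
  ultimately show ?thesis by (auto simp: H1_def)
qed

lemma test_vec_L2:
  fixes \<phi> :: "real^'d::finite \<Rightarrow> real^'d"
  assumes "open \<Omega>" "bounded \<Omega>" "\<And>j. test_fun \<Omega> (\<lambda>x. \<phi> x $ j)"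
  shows "L2 \<Omega> \<phi>" "L2 \<Omega> (cgrad \<phi>)"
proof -
  have "continuous_on UNIV (\<lambda>x. \<chi> j. \<phi> x $ j)"
    by (intro continuous_on_vec_lambda test_fun_continuous[OF assms(3)])
  then show "L2 \<Omega> \<phi>" using assms by (intro L2_continuous) auto
  have "continuous_on UNIV (cgrad \<phi>)"
    unfolding cgrad_def using test_fun_partial_continuous[OF assms(3)]
    by (intro continuous_on_vec_lambda) auto
  then show "L2 \<Omega> (cgrad \<phi>)" using assms by (intro L2_continuous) auto
qed

text \<open>The definition of \<open>H10\<close> supplies approximants with an explicit rate.
  Convergence in the mean yields an almost everywhere convergent subsequence \<open>r\<close>, and
  since \<open>r m\<close> is at least \<open>m\<close> the rate survives the passage to it.\<close>

lemma H10_approx: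
  fixes u :: "real^'d::finite \<Rightarrow> real^'d"
  assumes \<Omega>: "open \<Omega>" "bounded \<Omega>" and u: "H10 \<Omega> u"
  obtains \<phi> :: "nat \<Rightarrow> real^'d \<Rightarrow> real^'d" where
    "\<And>m j. test_fun \<Omega> (\<lambda>x. \<phi> m x $ j)"
    "\<And>m. omint \<Omega> (\<lambda>x. (norm (u x - \<phi> m x))\<^sup>2) \<le> (1 / real (Suc m))\<^sup>2"
    "\<And>m. omint \<Omega> (\<lambda>x. (norm (Grad \<Omega> u x - cgrad (\<phi> m) x))\<^sup>2) \<le> (1 / real (Suc m))\<^sup>2"
    "AE x in lebesgue_on \<Omega>. (\<lambda>m. \<phi> m x) \<longlonglongrightarrow> u x"
proof -
  have "\<forall>m. \<exists>\<phi>. (\<forall>j. test_fun \<Omega> (\<lambda>x. \<phi> x $ j)) \<and>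
      omint \<Omega> (\<lambda>x. (norm (u x - \<phi> x))\<^sup>2 + (norm (Grad \<Omega> u x - cgrad \<phi> x))\<^sup>2) < (1 / real (Suc m))\<^sup>2"
    by (rule allI, rule conjunct2[OF u[unfolded H10_def], rule_format]) simp
  from choice[OF this] obtain \<psi> where test: "\<And>m j. test_fun \<Omega> (\<lambda>x. \<psi> m x $ j)" and
    lt: "\<And>m. omint \<Omega> (\<lambda>x. (norm (u x - \<psi> m x))\<^sup>2 + (norm (Grad \<Omega> u x - cgrad (\<psi> m) x))\<^sup>2) < (1 / real (Suc m))\<^sup>2"
    by blast
  note Gu = H1_Grad[OF H10_imp_H1[OF u]]
  have int: "integrable (lebesgue_on \<Omega>) (\<lambda>x. (norm (u x - \<psi> m x))\<^sup>2)"
    "integrable (lebesgue_on \<Omega>) (\<lambda>x. (norm (Grad \<Omega> u x - cgrad (\<psi> m) x))\<^sup>2)" for m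
    by (intro L2_square_integrable L2_diff Gu test_vec_L2[OF \<Omega>] test)+
  have le: "omint \<Omega> (\<lambda>x. (norm (u x - \<psi> m x))\<^sup>2) \<le> (1 / real (Suc m))\<^sup>2"
    "omint \<Omega> (\<lambda>x. (norm (Grad \<Omega> u x - cgrad (\<psi> m) x))\<^sup>2) \<le> (1 / real (Suc m))\<^sup>2" for m
  proof -
    have "0 \<le> omint \<Omega> (\<lambda>x. (norm (u x - \<psi> m x))\<^sup>2)" "0 \<le> omint \<Omega> (\<lambda>x. (norm (Grad \<Omega> u x - cgrad (\<psi> m) x))\<^sup>2)"
      by (auto intro!: Bochner_Integration.integral_nonneg)
    then show "omint \<Omega> (\<lambda>x. (norm (u x - \<psi> m x))\<^sup>2) \<le> (1 / real (Suc m))\<^sup>2"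
      "omint \<Omega> (\<lambda>x. (norm (Grad \<Omega> u x - cgrad (\<psi> m) x))\<^sup>2) \<le> (1 / real (Suc m))\<^sup>2"
      using lt[of m] Bochner_Integration.integral_add[OF int(1)[of m] int(2)[of m]] by linarith+
  qed
  have "(\<lambda>m. (1 / real (Suc m))\<^sup>2) \<longlonglongrightarrow> 0\<^sup>2"
    by (intro tendsto_power LIMSEQ_Suc lim_1_over_n)
  then have lim: "(\<lambda>m. (1 / real (Suc m))\<^sup>2) \<longlonglongrightarrow> 0" by simp
  have "(\<lambda>m. omint \<Omega> (\<lambda>x. norm ((norm (u x - \<psi> m x))\<^sup>2))) \<longlonglongrightarrow> 0"
  proof (rule tendsto_sandwich[OF _ _ tendsto_const lim])
    show "\<forall>\<^sub>F m in sequentially. 0 \<le> omint \<Omega> (\<lambda>x. norm ((norm (u x - \<psi> m x))\<^sup>2))"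
      by (intro always_eventually allI Bochner_Integration.integral_nonneg norm_ge_zero)
    show "\<forall>\<^sub>F m in sequentially. omint \<Omega> (\<lambda>x. norm ((norm (u x - \<psi> m x))\<^sup>2)) \<le> (1 / real (Suc m))\<^sup>2"
      using le(1) by (intro always_eventually allI) simp
  qed
  then obtain r :: "nat \<Rightarrow> nat" where r: "strict_mono r"
    and ae: "AE x in lebesgue_on \<Omega>. (\<lambda>m. (norm (u x - \<psi> (r m) x))\<^sup>2) \<longlonglongrightarrow> 0"
    using tendsto_L1_AE_subseq[of "lebesgue_on \<Omega>" "\<lambda>m x. (norm (u x - \<psi> m x))\<^sup>2", OF int(1)] by auto
  have "(1 / real (Suc (r m)))\<^sup>2 \<le> (1 / real (Suc m))\<^sup>2" for m
    using seq_suble[OF r, of m] by (intro power_mono divide_left_mono) auto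
  then have sub: "omint \<Omega> (\<lambda>x. (norm (u x - \<psi> (r m) x))\<^sup>2) \<le> (1 / real (Suc m))\<^sup>2"
    "omint \<Omega> (\<lambda>x. (norm (Grad \<Omega> u x - cgrad (\<psi> (r m)) x))\<^sup>2) \<le> (1 / real (Suc m))\<^sup>2" for m
    by (rule order_trans[OF le(1)], rule order_trans[OF le(2)])
  have "AE x in lebesgue_on \<Omega>. (\<lambda>m. \<psi> (r m) x) \<longlonglongrightarrow> u x"
    using ae
  proof eventually_elim
    fix x assume "(\<lambda>m. (norm (u x - \<psi> (r m) x))\<^sup>2) \<longlonglongrightarrow> 0"
    then have "(\<lambda>m. norm (u x - \<psi> (r m) x)) \<longlonglongrightarrow> 0"
      using tendsto_real_sqrt[of "\<lambda>m. (norm (u x - \<psi> (r m) x))\<^sup>2" 0] by simp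
    then have "(\<lambda>m. norm (\<psi> (r m) x - u x)) \<longlonglongrightarrow> 0"
      by (simp add: norm_minus_commute)
    then show "(\<lambda>m. \<psi> (r m) x) \<longlonglongrightarrow> u x"
      by (rule LIM_zero_cancel[OF tendsto_norm_zero_cancel])
  qed
  then show thesis
    by (rule that[OF test sub])
qed

subsection \<open>Truncation\<close>

text \<open>The last bound is the essential one: it removes the factor |v| from the trilinear
  integrand, at the price of a constant depending on \<open>\<delta>\<close>. It follows from |v| <=
  1 + |v|^2 <= (1 + 1/\<delta>)(1 + \<delta>|v|^2).\<close>

lemma cutoff_bounds:
  assumes "0 < \<delta>"
  shows "0 < cutoff \<delta> v" "cutoff \<delta> v \<le> 1" "(cutoff \<delta> v)\<^sup>2 \<le> 1" "(cutoff \<delta> v)\<^sup>2 * norm v \<le> 1 + 1 / \<delta>"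
proof -
  have D: "0 < 1 + \<delta> * (norm v)\<^sup>2" using cutoff_arg_pos[OF assms] .
  have ge: "1 \<le> 1 + \<delta> * (norm v)\<^sup>2" using assms by simp
  show c0: "0 < cutoff \<delta> v" using D by (simp add: cutoff_def)
  show c1: "cutoff \<delta> v \<le> 1" using ge by (simp add: cutoff_def inverse_le_1_iff)
  show c2: "(cutoff \<delta> v)\<^sup>2 \<le> 1" using c0 c1 by (simp add: power_le_one)
  have "norm v \<le> 1 + (norm v)\<^sup>2"
    using sum_squares_bound[of 1 "norm v"] norm_ge_zero[of v] by (simp del: norm_ge_zero)
  also have "\<dots> \<le> (1 + 1 / \<delta>) * (1 + \<delta> * (norm v)\<^sup>2)"
    using assms by (simp add: field_simps)
  finally have "cutoff \<delta> v * norm v \<le> 1 + 1 / \<delta>"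
    using D by (simp add: cutoff_def field_simps)
  moreover have "(cutoff \<delta> v)\<^sup>2 * norm v \<le> cutoff \<delta> v * norm v"
    using c0 c1 by (intro mult_right_mono) (auto simp: power2_eq_square mult_left_le)
  ultimately show "(cutoff \<delta> v)\<^sup>2 * norm v \<le> 1 + 1 / \<delta>" by linarith
qed

lemma continuous_cutoff: "0 < \<delta> \<Longrightarrow> continuous_on UNIV (cutoff \<delta>)"
  unfolding cutoff_def[abs_def]
  by (intro continuous_intros) (metis cutoff_arg_pos less_irrefl)

lemma cutoff_borel_measurable:
  assumes "0 < \<delta>" "v \<in> borel_measurable M"
  shows "(\<lambda>x. cutoff \<delta> (v x)) \<in> borel_measurable M"
  by (rule borel_measurable_continuous_on[OF continuous_cutoff assms(2)]) fact

text \<open>The left form is visibly bounded and suits the truncated identities; the right form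
  shows the limit |v|^2/2 as \<open>\<delta>\<close> tends to 0.\<close>

lemma one_minus_cutoff: "0 < \<delta> \<Longrightarrow> 1 / (2 * \<delta>) * (1 - cutoff \<delta> v) = 1 / 2 * (norm v)\<^sup>2 * cutoff \<delta> v"
  using cutoff_arg_pos[of \<delta> v] by (simp add: cutoff_def field_simps)

text \<open>The cutoff absorbs the growth in \<open>v\<close>, so measurability of \<open>v\<close>
  is enough and the product of |A| and |w| is a majorant that does not depend on \<open>v\<close>.
  This majorant later drives dominated convergence.\<close>

lemma L2_form_integrable:
  fixes w v :: "real^'d::finite \<Rightarrow> real^'d"
  assumes "0 < \<delta>" "L2 \<Omega> A" "L2 \<Omega> w" "v \<in> borel_measurable (lebesgue_on \<Omega>)"
  shows "integrable (lebesgue_on \<Omega>) (\<lambda>x. (cutoff \<delta> (v x))\<^sup>2 * ((A x *v w x) \<bullet> v x))"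
    and "\<bar>(cutoff \<delta> (v x))\<^sup>2 * ((A x *v w x) \<bullet> v x)\<bar> \<le> (1 + 1 / \<delta>) * (norm (A x) * norm (w x))"
proof -
  show le: "\<bar>(cutoff \<delta> (v x))\<^sup>2 * ((A x *v w x) \<bullet> v x)\<bar> \<le> (1 + 1 / \<delta>) * (norm (A x) * norm (w x))" for x
  proof -
    have "\<bar>(cutoff \<delta> (v x))\<^sup>2 * ((A x *v w x) \<bullet> v x)\<bar>
        \<le> (cutoff \<delta> (v x))\<^sup>2 * (norm (A x) * norm (w x) * norm (v x))"
      unfolding abs_mult using matrix_form_le by (intro mult_mono) auto
    also have "\<dots> = (cutoff \<delta> (v x))\<^sup>2 * norm (v x) * (norm (A x) * norm (w x))"
      by simp
    also have "\<dots> \<le> (1 + 1 / \<delta>) * (norm (A x) * norm (w x))"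
      by (intro mult_right_mono cutoff_bounds assms) auto
    finally show ?thesis .
  qed
  show "integrable (lebesgue_on \<Omega>) (\<lambda>x. (cutoff \<delta> (v x))\<^sup>2 * ((A x *v w x) \<bullet> v x))"
    by (rule L2_product_integrable[OF assms(2,3) _ le])
       (intro borel_measurable_times borel_measurable_power borel_measurable_matrix_form
         cutoff_borel_measurable L2_measurable assms)
qed

lemma L2_const:
  assumes "open \<Omega>" "bounded \<Omega>"
  shows "L2 \<Omega> (\<lambda>x :: real^'d::finite. 1 :: real)"
  by (intro L2_continuous assms continuous_intros)

text \<open>The truncation is bounded by 1/(2\<delta>), and a square integrable function on a
  bounded domain is integrable by pairing it with the constant 1.\<close>

lemma L2_truncated_integrable:
  fixes g :: "real^'d::finite \<Rightarrow> real" and v :: "real^'d \<Rightarrow> real^'d"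
  assumes "open \<Omega>" "bounded \<Omega>" "0 < \<delta>" "L2 \<Omega> g" "v \<in> borel_measurable (lebesgue_on \<Omega>)"
  shows "integrable (lebesgue_on \<Omega>) (\<lambda>x. g x * (1 / (2 * \<delta>) * (1 - cutoff \<delta> (v x))))"
    and "\<bar>g x * (1 / (2 * \<delta>) * (1 - cutoff \<delta> (v x)))\<bar> \<le> 1 / (2 * \<delta>) * \<bar>g x\<bar>"
proof -
  show le: "\<bar>g x * (1 / (2 * \<delta>) * (1 - cutoff \<delta> (v x)))\<bar> \<le> 1 / (2 * \<delta>) * \<bar>g x\<bar>" for x
  proof -
    have "\<bar>1 - cutoff \<delta> (v x)\<bar> \<le> 1" using cutoff_bounds[OF assms(3), of "v x"] by linarith
    then have "1 / (2 * \<delta>) * \<bar>g x\<bar> * \<bar>1 - cutoff \<delta> (v x)\<bar> \<le> 1 / (2 * \<delta>) * \<bar>g x\<bar> * 1"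
      using assms(3) by (intro mult_left_mono) auto
    then show ?thesis using assms(3) by (simp add: abs_mult mult_ac)
  qed
  show "integrable (lebesgue_on \<Omega>) (\<lambda>x. g x * (1 / (2 * \<delta>) * (1 - cutoff \<delta> (v x))))"
  proof (rule L2_product_integrable[OF assms(4) L2_const[OF assms(1,2)]])
    show "\<bar>g x * (1 / (2 * \<delta>) * (1 - cutoff \<delta> (v x)))\<bar> \<le> 1 / (2 * \<delta>) * (norm (g x) * norm (1::real))" for x
      using le[of x] by simp
  qed (intro borel_measurable_times borel_measurable_diff borel_measurable_const
      cutoff_borel_measurable L2_measurable assms)
qed

text \<open>The truncated energy \<open>T\<close> of \<open>\<phi>\<close> is inserted in the weak
  gradient of \<open>w\<close> for the diagonal index pairs only; their sum says that w . grad T + T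
  div w has integral zero. The compact support of \<open>T\<close> takes care of the boundary, where
  \<open>w\<close> is unrestricted.\<close>

lemma truncated_identity_test:
  fixes w \<phi> :: "real^'d::finite \<Rightarrow> real^'d"
  assumes \<Omega>: "open \<Omega>" "bounded \<Omega>" and \<delta>: "0 < \<delta>"
    and w: "L2 \<Omega> w" "L2 \<Omega> G" "weak_grad \<Omega> w G"
    and \<phi>: "\<And>j. test_fun \<Omega> (\<lambda>x. \<phi> x $ j)"
  shows "omint \<Omega> (\<lambda>x. (cutoff \<delta> (\<phi> x))\<^sup>2 * ((cgrad \<phi> x *v w x) \<bullet> \<phi> x)
    + (\<Sum>j\<in>UNIV. G x $ j $ j) * (1 / (2 * \<delta>) * (1 - cutoff \<delta> (\<phi> x)))) = 0"
proof -
  define T where "T = (\<lambda>x. 1 / (2 * \<delta>) * (1 - cutoff \<delta> (\<phi> x)))"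
  have test: "test_fun \<Omega> T" unfolding T_def by (rule smooth_truncated_energy(1)[OF \<phi> \<delta>])
  have pd: "partial_deriv i T x = (cutoff \<delta> (\<phi> x))\<^sup>2 * (\<Sum>j\<in>UNIV. \<phi> x $ j * cgrad \<phi> x $ j $ i)" for i x
    unfolding T_def by (rule smooth_truncated_energy(2)[OF \<phi> \<delta>])
  have L: "L2 \<Omega> T" "L2 \<Omega> (partial_deriv i T)" for i
    using \<Omega> test by (auto intro!: L2_continuous test_fun_continuous test_fun_partial_continuous)
  have int: "integrable (lebesgue_on \<Omega>) (\<lambda>x. w x $ i * partial_deriv i T x)"
     "integrable (lebesgue_on \<Omega>) (\<lambda>x. G x $ i $ i * T x)" for i
    using L2_inner_integrable[OF L2_vec_nth[OF w(1)] L(2)]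
      L2_inner_integrable[OF L2_vec_nth[OF L2_vec_nth[OF w(2)]] L(1)] by auto
  have alg: "(cutoff \<delta> (\<phi> x))\<^sup>2 * ((cgrad \<phi> x *v w x) \<bullet> \<phi> x) + (\<Sum>j\<in>UNIV. G x $ j $ j) * T x
      = (\<Sum>i\<in>UNIV. w x $ i * partial_deriv i T x + G x $ i $ i * T x)" for x
  proof -
    have "(cgrad \<phi> x *v w x) \<bullet> \<phi> x = (\<Sum>j\<in>UNIV. \<Sum>i\<in>UNIV. w x $ i * (\<phi> x $ j * cgrad \<phi> x $ j $ i))"
      by (simp add: inner_vec_def matrix_vector_mult_def sum_distrib_left sum_distrib_right mult_ac)
    also have "\<dots> = (\<Sum>i\<in>UNIV. w x $ i * (\<Sum>j\<in>UNIV. \<phi> x $ j * cgrad \<phi> x $ j $ i))"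
      by (subst sum.swap) (simp add: sum_distrib_left)
    finally show ?thesis
      by (simp add: pd sum.distrib sum_distrib_left sum_distrib_right mult_ac)
  qed
  have "omint \<Omega> (\<lambda>x. (cutoff \<delta> (\<phi> x))\<^sup>2 * ((cgrad \<phi> x *v w x) \<bullet> \<phi> x) + (\<Sum>j\<in>UNIV. G x $ j $ j) * T x)
      = (\<Sum>i\<in>UNIV. omint \<Omega> (\<lambda>x. w x $ i * partial_deriv i T x) + omint \<Omega> (\<lambda>x. G x $ i $ i * T x))"
    unfolding alg using int by (subst Bochner_Integration.integral_sum) auto
  also have "\<dots> = 0"
    using w(3) test by (simp add: weak_grad_def)
  finally show ?thesis by (simp add: T_def)
qed

text \<open>The mixed integrals, with the gradient of \<open>u\<close> but the test fields
  \<open>\<phi> m\<close> in place of \<open>u\<close> itself, are computed in the limit twice: they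
  converge to the left-hand side and also to zero.\<close>

lemma truncated_identity:
  fixes w u :: "real^'d::finite \<Rightarrow> real^'d"
  assumes \<Omega>: "open \<Omega>" "bounded \<Omega>" and \<delta>: "0 < \<delta>"
    and w: "L2 \<Omega> w" "L2 \<Omega> G" "weak_grad \<Omega> w G"
    and u: "H10 \<Omega> u"
  shows "omint \<Omega> (\<lambda>x. (cutoff \<delta> (u x))\<^sup>2 * ((Grad \<Omega> u x *v w x) \<bullet> u x)
    + (\<Sum>j\<in>UNIV. G x $ j $ j) * (1 / (2 * \<delta>) * (1 - cutoff \<delta> (u x)))) = 0"
proof -
  note Gu = H1_Grad[OF H10_imp_H1[OF u]]
  obtain \<phi> where test: "\<And>m j. test_fun \<Omega> (\<lambda>x. \<phi> m x $ j)"
    and "\<And>m. omint \<Omega> (\<lambda>x. (norm (u x - \<phi> m x))\<^sup>2) \<le> (1 / real (Suc m))\<^sup>2"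
    and err: "\<And>m. omint \<Omega> (\<lambda>x. (norm (Grad \<Omega> u x - cgrad (\<phi> m) x))\<^sup>2) \<le> (1 / real (Suc m))\<^sup>2"
    and ae: "AE x in lebesgue_on \<Omega>. (\<lambda>m. \<phi> m x) \<longlonglongrightarrow> u x"
    by (rule H10_approx[OF \<Omega> u]) (rule that)
  note L\<phi> = test_vec_L2[OF \<Omega> test]
  define tr where "tr x = (\<Sum>j\<in>UNIV. G x $ j $ j)" for x
  have tr: "L2 \<Omega> tr" unfolding tr_def[abs_def] by (rule L2_trace[OF w(2)])
  define K where "K = 1 + 1 / \<delta>"
  have K: "0 < K" using \<delta> by (simp add: K_def add_pos_nonneg)
  let ?b = "\<lambda>v x. tr x * (1 / (2 * \<delta>) * (1 - cutoff \<delta> (v x)))"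
  let ?a = "\<lambda>A v x. (cutoff \<delta> (v x))\<^sup>2 * ((A x *v w x) \<bullet> v x)"
  have mu: "u \<in> borel_measurable (lebesgue_on \<Omega>)" and m\<phi>: "\<phi> m \<in> borel_measurable (lebesgue_on \<Omega>)" for m
    using Gu(1) L\<phi>(1) by (auto intro: L2_measurable)
  have inta: "integrable (lebesgue_on \<Omega>) (?a A v)" if "L2 \<Omega> A" "v \<in> borel_measurable (lebesgue_on \<Omega>)"
    for A :: "real^'d \<Rightarrow> real^'d^'d" and v :: "real^'d \<Rightarrow> real^'d"
    by (rule L2_form_integrable(1)[OF \<delta> that(1) w(1) that(2)])
  have intb: "integrable (lebesgue_on \<Omega>) (?b v)" if "v \<in> borel_measurable (lebesgue_on \<Omega>)"
    for v :: "real^'d \<Rightarrow> real^'d"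
    by (rule L2_truncated_integrable(1)[OF \<Omega> \<delta> tr that])
  \<comment> \<open>With the gradient held fixed, one integrable majorant serves all
    \<open>m\<close>, and the continuity of the cutoff gives pointwise convergence.\<close>
  have J: "(\<lambda>m. omint \<Omega> (\<lambda>x. ?a (Grad \<Omega> u) (\<phi> m) x + ?b (\<phi> m) x)) \<longlonglongrightarrow>
     omint \<Omega> (\<lambda>x. ?a (Grad \<Omega> u) u x + ?b u x)"
  proof (rule integral_dominated_convergence[where w = "\<lambda>x. K * (norm (Grad \<Omega> u x) * norm (w x)) + 1 / (2 * \<delta>) * \<bar>tr x\<bar>"])
    have "integrable (lebesgue_on \<Omega>) (\<lambda>x. K * (norm (Grad \<Omega> u x) * norm (w x)))"
      by (rule L2_product_integrable[OF Gu(2) w(1), where C = K])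
         (use K L2_measurable[OF Gu(2)] L2_measurable[OF w(1)] in auto)
    moreover have "integrable (lebesgue_on \<Omega>) (\<lambda>x. 1 / (2 * \<delta>) * \<bar>tr x\<bar>)"
      by (rule L2_product_integrable[OF tr L2_const[OF \<Omega>], where C = "1 / (2 * \<delta>)"])
         (use \<delta> L2_measurable[OF tr] in auto)
    ultimately show "integrable (lebesgue_on \<Omega>) (\<lambda>x. K * (norm (Grad \<Omega> u x) * norm (w x)) + 1 / (2 * \<delta>) * \<bar>tr x\<bar>)"
      by (rule Bochner_Integration.integrable_add)
    show "(\<lambda>x. ?a (Grad \<Omega> u) u x + ?b u x) \<in> borel_measurable (lebesgue_on \<Omega>)"
      by (intro borel_measurable_add borel_measurable_integrable[OF inta] borel_measurable_integrable[OF intb] mu Gu)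
    show "(\<lambda>x. ?a (Grad \<Omega> u) (\<phi> m) x + ?b (\<phi> m) x) \<in> borel_measurable (lebesgue_on \<Omega>)" for m
      by (intro borel_measurable_add borel_measurable_integrable[OF inta] borel_measurable_integrable[OF intb] m\<phi> Gu)
    show "AE x in lebesgue_on \<Omega>. norm (?a (Grad \<Omega> u) (\<phi> m) x + ?b (\<phi> m) x)
       \<le> K * (norm (Grad \<Omega> u x) * norm (w x)) + 1 / (2 * \<delta>) * \<bar>tr x\<bar>" for m
      unfolding K_def real_norm_def
      by (intro AE_I2 order_trans[OF abs_triangle_ineq] add_mono
          L2_form_integrable(2)[OF \<delta> Gu(2) w(1) m\<phi>] L2_truncated_integrable(2)[OF \<Omega> \<delta> tr m\<phi>])
    show "AE x in lebesgue_on \<Omega>. (\<lambda>m. ?a (Grad \<Omega> u) (\<phi> m) x + ?b (\<phi> m) x) \<longlonglongrightarrow> ?a (Grad \<Omega> u) u x + ?b u x"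
      using ae
    proof eventually_elim
      fix x assume lim: "(\<lambda>m. \<phi> m x) \<longlonglongrightarrow> u x"
      have "(\<lambda>m. cutoff \<delta> (\<phi> m x)) \<longlonglongrightarrow> cutoff \<delta> (u x)"
        by (rule continuous_on_tendsto_compose[OF continuous_cutoff[OF \<delta>] lim]) auto
      then show "(\<lambda>m. ?a (Grad \<Omega> u) (\<phi> m) x + ?b (\<phi> m) x) \<longlonglongrightarrow> ?a (Grad \<Omega> u) u x + ?b u x"
        using lim by (intro tendsto_intros)
    qed
  qed
  \<comment> \<open>Subtracting the identity for the test field cancels the divergence terms and
    leaves a form in the gradient error alone, which is of order 1/(m+1).\<close>
  have "(\<lambda>m. omint \<Omega> (\<lambda>x. ?a (Grad \<Omega> u) (\<phi> m) x + ?b (\<phi> m) x)) \<longlonglongrightarrow> 0"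
  proof (rule tendsto_0_le[where K = 1])
    define W where "W = omint \<Omega> (\<lambda>x. (norm (w x))\<^sup>2)"
    have "(\<lambda>m. K * (W + 1) * (1 / real (Suc m))) \<longlonglongrightarrow> K * (W + 1) * 0"
      by (intro tendsto_intros LIMSEQ_Suc lim_1_over_n)
    then show "(\<lambda>m. K * (W + 1) * (1 / real (Suc m))) \<longlonglongrightarrow> 0" by simp
    have bound: "\<bar>omint \<Omega> (\<lambda>x. ?a (Grad \<Omega> u) (\<phi> m) x + ?b (\<phi> m) x)\<bar> \<le> K * (W + 1) * (1 / real (Suc m))" for m
    proof -
      \<comment> \<open>The weight in Young's inequality: the squared gradient error integrates to
        at most e^2, so after division by \<open>e\<close> both resulting terms are of order
        \<open>e\<close>.\<close>
      define e where "e = 1 / real (Suc m)"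
      have e: "0 < e" by (simp add: e_def)
      let ?D = "\<lambda>x. Grad \<Omega> u x - cgrad (\<phi> m) x"
      have LD: "L2 \<Omega> ?D" by (intro L2_diff Gu L\<phi>)
      have intD: "integrable (lebesgue_on \<Omega>) (?a ?D (\<phi> m))"
        by (rule inta[OF LD m\<phi>])
      have "omint \<Omega> (\<lambda>x. ?a (cgrad (\<phi> m)) (\<phi> m) x + ?b (\<phi> m) x) = 0"
        unfolding tr_def by (rule truncated_identity_test[OF \<Omega> \<delta> w test])
      then have "omint \<Omega> (\<lambda>x. ?a (Grad \<Omega> u) (\<phi> m) x + ?b (\<phi> m) x)
         = omint \<Omega> (\<lambda>x. ?a (Grad \<Omega> u) (\<phi> m) x + ?b (\<phi> m) x)
           - omint \<Omega> (\<lambda>x. ?a (cgrad (\<phi> m)) (\<phi> m) x + ?b (\<phi> m) x)" by simp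
      also have "\<dots> = omint \<Omega> (\<lambda>x. (?a (Grad \<Omega> u) (\<phi> m) x + ?b (\<phi> m) x)
           - (?a (cgrad (\<phi> m)) (\<phi> m) x + ?b (\<phi> m) x))"
        by (intro Bochner_Integration.integral_diff[symmetric] Bochner_Integration.integrable_add
            inta intb Gu L\<phi> m\<phi>)
      also have "\<dots> = omint \<Omega> (?a ?D (\<phi> m))"
        by (simp add: matrix_vector_mult_diff_rdistrib inner_diff_left right_diff_distrib)
      finally have "\<bar>omint \<Omega> (\<lambda>x. ?a (Grad \<Omega> u) (\<phi> m) x + ?b (\<phi> m) x)\<bar> = \<bar>omint \<Omega> (?a ?D (\<phi> m))\<bar>"
        by simp
      also have "\<dots> \<le> omint \<Omega> (\<lambda>x. \<bar>?a ?D (\<phi> m) x\<bar>)"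
        by (rule integral_abs_bound)
      also have "\<dots> \<le> omint \<Omega> (\<lambda>x. K * (e * (norm (w x))\<^sup>2 + (1 / e) * (norm (?D x))\<^sup>2))"
      proof (rule integral_mono)
        show "integrable (lebesgue_on \<Omega>) (\<lambda>x. \<bar>?a ?D (\<phi> m) x\<bar>)"
          using intD by simp
        show "integrable (lebesgue_on \<Omega>) (\<lambda>x. K * (e * (norm (w x))\<^sup>2 + (1 / e) * (norm (?D x))\<^sup>2))"
          by (intro Bochner_Integration.integrable_add integrable_mult_right L2_square_integrable w LD)
        fix x
        have "norm (?D x) * norm (w x) \<le> e * (norm (w x))\<^sup>2 + (1 / e) * (norm (?D x))\<^sup>2"
        proof -
          have "2 * (norm (?D x) * (e * norm (w x))) \<le> (norm (?D x))\<^sup>2 + (e * norm (w x))\<^sup>2"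
            using sum_squares_bound[of "norm (?D x)" "e * norm (w x)"] by simp
          moreover have "0 \<le> norm (?D x) * (e * norm (w x))" using e by simp
          ultimately have "norm (?D x) * (e * norm (w x)) \<le> (norm (?D x))\<^sup>2 + (e * norm (w x))\<^sup>2" by linarith
          then show ?thesis using e by (simp add: field_simps power2_eq_square)
        qed
        then have "K * (norm (?D x) * norm (w x)) \<le> K * (e * (norm (w x))\<^sup>2 + (1 / e) * (norm (?D x))\<^sup>2)"
          using K by (intro mult_left_mono) auto
        then show "\<bar>?a ?D (\<phi> m) x\<bar> \<le> K * (e * (norm (w x))\<^sup>2 + (1 / e) * (norm (?D x))\<^sup>2)"
          using L2_form_integrable(2)[OF \<delta> LD w(1) m\<phi>, of m x] unfolding K_def by linarith
      qed
      also have "\<dots> = K * (e * W + (1 / e) * omint \<Omega> (\<lambda>x. (norm (?D x))\<^sup>2))"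
        using L2_square_integrable[OF LD] L2_square_integrable[OF w(1)] by (simp add: W_def)
      also have "\<dots> \<le> K * (e * W + (1 / e) * e\<^sup>2)"
        using err[of m] K e unfolding e_def[symmetric]
        by (intro mult_left_mono add_left_mono) auto
      also have "\<dots> = K * (W + 1) * e"
        using e by (simp add: power2_eq_square field_simps)
      finally show ?thesis by (simp add: e_def)
    qed
    have "0 \<le> W" by (simp add: W_def Bochner_Integration.integral_nonneg)
    then have "0 \<le> K * (W + 1) * (1 / real (Suc m))" for m using K by simp
    then show "\<forall>\<^sub>F m in sequentially. norm (omint \<Omega> (\<lambda>x. ?a (Grad \<Omega> u) (\<phi> m) x + ?b (\<phi> m) x))
        \<le> norm (K * (W + 1) * (1 / real (Suc m))) * 1"
      using bound by (intro always_eventually allI) (simp only: real_norm_def abs_of_nonneg mult_1_right)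
  qed
  then show ?thesis
    using LIMSEQ_unique[OF J] unfolding tr_def by simp
qed

subsection \<open>Integrability and skew symmetry\<close>

text \<open>Links the whole-space Borel integrals of the slicing argument with the Lebesgue
  integrals over \<open>\<Omega>\<close> that define the function spaces.\<close>

lemma nn_integral_lborel_eq_lebesgue_on:
  assumes "\<Omega> \<in> sets lebesgue" "\<And>x. x \<notin> \<Omega> \<Longrightarrow> f x = 0"
  shows "(\<integral>\<^sup>+x. f x \<partial>lborel) = (\<integral>\<^sup>+x. f x \<partial>lebesgue_on \<Omega>)"
proof -
  have "(\<integral>\<^sup>+x. f x \<partial>lebesgue_on \<Omega>) = (\<integral>\<^sup>+x. f x * indicator \<Omega> x \<partial>lebesgue)"
    using assms(1) by (intro nn_integral_restrict_space) simp
  also have "\<dots> = (\<integral>\<^sup>+x. f x \<partial>lebesgue)"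
    using assms(2) by (intro nn_integral_cong) (auto simp: indicator_def)
  finally show ?thesis by (simp add: nn_integral_completion)
qed

lemma norm_sq_le_twice: "(norm (v :: 'a::real_normed_vector))\<^sup>2 \<le> 2 * (norm u)\<^sup>2 + 2 * (norm (u - v))\<^sup>2"
proof -
  have "(norm v)\<^sup>2 \<le> (norm u + norm (u - v))\<^sup>2"
    by (intro power_mono) (use norm_triangle_ineq4[of u "u - v"] in auto)
  then show ?thesis
    using sum_squares_bound[of "norm u" "norm (u - v)"] by (simp add: power2_sum)
qed

lemma norm_sq_component_sum_le:
  fixes v :: "real^'d" and A :: "real^'d^'d"
  shows "(v $ j)\<^sup>2 + (\<Sum>i\<in>UNIV. (A $ j $ i)\<^sup>2) \<le> (norm v)\<^sup>2 + (norm A)\<^sup>2"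
proof -
  have "(v $ j)\<^sup>2 \<le> (norm v)\<^sup>2"
    using component_le_norm_cart[of v j] by (metis abs_le_square_iff abs_norm_cancel)
  moreover have "(\<Sum>i\<in>UNIV. (A $ j $ i)\<^sup>2) = (norm (A $ j))\<^sup>2"
    unfolding norm_vec_sq by (simp add: power2_eq_square)
  moreover have "(norm (A $ j))\<^sup>2 \<le> (norm A)\<^sup>2"
    by (intro power_mono Finite_Cartesian_Product.norm_nth_le) auto
  ultimately show ?thesis by linarith
qed

text \<open>The H^1 energies of the approximating test fields are bounded uniformly, hence so are
  the integrals of their fourth powers, and Fatou's lemma carries this bound to the almost
  everywhere limit.\<close>

lemma H10_component_L4:
  fixes u :: "real^'d::finite \<Rightarrow> real^'d"
  assumes dim: "CARD('d) = 2 \<or> CARD('d) = 3"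
    and \<Omega>: "open \<Omega>" "bounded \<Omega>" and u: "H10 \<Omega> u"
  shows "integrable (lebesgue_on \<Omega>) (\<lambda>x. (u x $ j)^4)"
proof -
  note Gu = H1_Grad[OF H10_imp_H1[OF u]]
  obtain \<phi> where test: "\<And>m j. test_fun \<Omega> (\<lambda>x. \<phi> m x $ j)"
    and err0: "\<And>m. omint \<Omega> (\<lambda>x. (norm (u x - \<phi> m x))\<^sup>2) \<le> (1 / real (Suc m))\<^sup>2"
    and err1: "\<And>m. omint \<Omega> (\<lambda>x. (norm (Grad \<Omega> u x - cgrad (\<phi> m) x))\<^sup>2) \<le> (1 / real (Suc m))\<^sup>2"
    and ae: "AE x in lebesgue_on \<Omega>. (\<lambda>m. \<phi> m x) \<longlonglongrightarrow> u x"
    by (rule H10_approx[OF \<Omega> u]) (rule that)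
  note L\<phi> = test_vec_L2[OF \<Omega> test]
  have \<Omega>m: "\<Omega> \<in> sets lebesgue" using \<Omega> by simp
  \<comment> \<open>Twice the squared norms of \<open>u\<close> and its gradient, plus twice the two
    squared errors, each of which is at most 1.\<close>
  define B where "B = 2 * omint \<Omega> (\<lambda>x. (norm (u x))\<^sup>2) + 2 * omint \<Omega> (\<lambda>x. (norm (Grad \<Omega> u x))\<^sup>2) + 4"
  have energy: "(\<integral>\<^sup>+x. ennreal ((\<phi> m x $ j)\<^sup>2 + (\<Sum>i\<in>UNIV. (partial_deriv i (\<lambda>x. \<phi> m x $ j) x)\<^sup>2)) \<partial>lborel) \<le> ennreal B" for m
  proof -
    let ?g = "\<lambda>x. 2 * (norm (u x))\<^sup>2 + 2 * (norm (u x - \<phi> m x))\<^sup>2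
      + (2 * (norm (Grad \<Omega> u x))\<^sup>2 + 2 * (norm (Grad \<Omega> u x - cgrad (\<phi> m) x))\<^sup>2)"
    have sq: "integrable (lebesgue_on \<Omega>) (\<lambda>x. (norm (u x))\<^sup>2)"
      "integrable (lebesgue_on \<Omega>) (\<lambda>x. (norm (u x - \<phi> m x))\<^sup>2)"
      "integrable (lebesgue_on \<Omega>) (\<lambda>x. (norm (Grad \<Omega> u x))\<^sup>2)"
      "integrable (lebesgue_on \<Omega>) (\<lambda>x. (norm (Grad \<Omega> u x - cgrad (\<phi> m) x))\<^sup>2)"
      by (intro L2_square_integrable L2_diff Gu L\<phi>)+
    have "(\<integral>\<^sup>+x. ennreal ((\<phi> m x $ j)\<^sup>2 + (\<Sum>i\<in>UNIV. (partial_deriv i (\<lambda>x. \<phi> m x $ j) x)\<^sup>2)) \<partial>lborel)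
       = (\<integral>\<^sup>+x. ennreal ((\<phi> m x $ j)\<^sup>2 + (\<Sum>i\<in>UNIV. (partial_deriv i (\<lambda>x. \<phi> m x $ j) x)\<^sup>2)) \<partial>lebesgue_on \<Omega>)"
      by (rule nn_integral_lborel_eq_lebesgue_on[OF \<Omega>m])
         (simp add: test_fun_eq_0[OF test] test_fun_partial_eq_0[OF test])
    also have "\<dots> \<le> (\<integral>\<^sup>+x. ennreal (?g x) \<partial>lebesgue_on \<Omega>)"
    proof (intro nn_integral_mono ennreal_leI)
      fix x
      show "(\<phi> m x $ j)\<^sup>2 + (\<Sum>i\<in>UNIV. (partial_deriv i (\<lambda>x. \<phi> m x $ j) x)\<^sup>2) \<le> ?g x"
        using norm_sq_component_sum_le[of "\<phi> m x" j "cgrad (\<phi> m) x"]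
          norm_sq_le_twice[of "\<phi> m x" "u x"] norm_sq_le_twice[of "cgrad (\<phi> m) x" "Grad \<Omega> u x"]
        by (simp add: cgrad_def[of "\<phi> m" x])
    qed
    also have "\<dots> = ennreal (omint \<Omega> ?g)"
      using sq by (intro nn_integral_eq_integral) auto
    also have "\<dots> \<le> ennreal B"
    proof (rule ennreal_leI)
      have "(1 / real (Suc m))\<^sup>2 \<le> 1" by (simp add: power_le_one)
      moreover have "omint \<Omega> ?g = 2 * omint \<Omega> (\<lambda>x. (norm (u x))\<^sup>2) + 2 * omint \<Omega> (\<lambda>x. (norm (u x - \<phi> m x))\<^sup>2)
        + (2 * omint \<Omega> (\<lambda>x. (norm (Grad \<Omega> u x))\<^sup>2) + 2 * omint \<Omega> (\<lambda>x. (norm (Grad \<Omega> u x - cgrad (\<phi> m) x))\<^sup>2))"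
        using sq by simp
      ultimately show "omint \<Omega> ?g \<le> B"
        using err0[of m] err1[of m] unfolding B_def by linarith
    qed
    finally show ?thesis .
  qed
  have m\<phi>: "(\<lambda>x. \<phi> m x $ j) \<in> borel_measurable (lebesgue_on \<Omega>)" for m
    by (intro L2_measurable L2_vec_nth L\<phi>)
  have mu: "(\<lambda>x. u x $ j) \<in> borel_measurable (lebesgue_on \<Omega>)"
    by (intro L2_measurable L2_vec_nth Gu)
  have L4: "(\<integral>\<^sup>+x. ennreal ((\<phi> m x $ j)^4) \<partial>lebesgue_on \<Omega>) \<le> 2 * (ennreal B)\<^sup>2" for m
  proof -
    have "(\<integral>\<^sup>+x. ennreal ((\<phi> m x $ j)^4) \<partial>lebesgue_on \<Omega>) = (\<integral>\<^sup>+x. ennreal ((\<phi> m x $ j)^4) \<partial>lborel)"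
      by (rule nn_integral_lborel_eq_lebesgue_on[OF \<Omega>m, symmetric]) (simp add: test_fun_eq_0[OF test])
    also have "\<dots> \<le> 2 * (\<integral>\<^sup>+x. ennreal ((\<phi> m x $ j)\<^sup>2 + (\<Sum>i\<in>UNIV. (partial_deriv i (\<lambda>x. \<phi> m x $ j) x)\<^sup>2)) \<partial>lborel)\<^sup>2"
      by (rule test_fun_L4_bound[OF dim test])
    also have "\<dots> \<le> 2 * (ennreal B)\<^sup>2"
      by (intro mult_left_mono power_mono energy) auto
    finally show ?thesis .
  qed
  have "(\<integral>\<^sup>+x. ennreal ((u x $ j)^4) \<partial>lebesgue_on \<Omega>)
      = (\<integral>\<^sup>+x. liminf (\<lambda>m. ennreal ((\<phi> m x $ j)^4)) \<partial>lebesgue_on \<Omega>)"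
  proof (rule nn_integral_cong_AE)
    show "AE x in lebesgue_on \<Omega>. ennreal ((u x $ j)^4) = liminf (\<lambda>m. ennreal ((\<phi> m x $ j)^4))"
      using ae
    proof eventually_elim
      fix x assume "(\<lambda>m. \<phi> m x) \<longlonglongrightarrow> u x"
      then have "(\<lambda>m. ennreal ((\<phi> m x $ j)^4)) \<longlonglongrightarrow> ennreal ((u x $ j)^4)"
        by (intro tendsto_ennrealI tendsto_power tendsto_vec_nth)
      then show "ennreal ((u x $ j)^4) = liminf (\<lambda>m. ennreal ((\<phi> m x $ j)^4))"
        by (intro lim_imp_Liminf[symmetric]) auto
    qed
  qed
  also have "\<dots> \<le> liminf (\<lambda>m. \<integral>\<^sup>+x. ennreal ((\<phi> m x $ j)^4) \<partial>lebesgue_on \<Omega>)"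
    using m\<phi> by (intro nn_integral_liminf) auto
  also have "\<dots> \<le> liminf (\<lambda>m. 2 * (ennreal B)\<^sup>2)"
    by (intro Liminf_mono always_eventually allI L4)
  also have "\<dots> = 2 * (ennreal B)\<^sup>2" by (simp add: Liminf_const)
  also have "\<dots> < \<infinity>" by (simp add: ennreal_mult_less_top power2_eq_square)
  finally show ?thesis
    using mu by (intro integrableI_bounded) auto
qed

lemma H10_norm_sq_L2:
  fixes u :: "real^'d::finite \<Rightarrow> real^'d"
  assumes "CARD('d) = 2 \<or> CARD('d) = 3" "open \<Omega>" "bounded \<Omega>" "H10 \<Omega> u"
  shows "L2 \<Omega> (\<lambda>x. (norm (u x))\<^sup>2)"
proof -
  have comp: "L2 \<Omega> (\<lambda>x. (u x $ j)\<^sup>2)" for j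
    unfolding L2_def using H10_component_L4[OF assms, of j]
      L2_measurable[OF L2_vec_nth[OF H1_Grad(1)[OF H10_imp_H1[OF assms(4)]], of j]]
    by (auto simp flip: power_mult)
  have "L2 \<Omega> (\<lambda>x. \<Sum>j\<in>I. (u x $ j)\<^sup>2)" if "finite I" for I
    using that by (induction I rule: finite_induct) (simp_all add: L2_add comp, simp add: L2_def)
  from this[of UNIV] show ?thesis unfolding norm_vec_sq by (simp add: power2_eq_square)
qed

text \<open>Formally the integrand is the divergence of w|u|^2/2, which integrates to zero because
  \<open>u\<close> vanishes on the boundary. The truncated identity makes this rigorous as
  \<open>\<delta>\<close> tends to 0.\<close>

lemma bstar_self_eq_0:
  fixes u w :: "real^'d::finite \<Rightarrow> real^'d"
  assumes dim: "CARD('d) = 2 \<or> CARD('d) = 3"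
    and \<Omega>: "open \<Omega>" "bounded \<Omega>" and u: "H10 \<Omega> u" and w: "H1 \<Omega> w"
  shows "bstar \<Omega> w u u = 0"
proof (cases "integrable (lebesgue_on \<Omega>) (\<lambda>x. (Grad \<Omega> u x *v w x) \<bullet> u x + (1/2) * Div \<Omega> w x * (u x \<bullet> u x))")
  case False
  then show ?thesis by (simp add: bstar_def not_integrable_integral_eq)
next
  case True
  note Gu = H1_Grad[OF H10_imp_H1[OF u]] and Gw = H1_Grad[OF w]
  let ?a = "\<lambda>x. (Grad \<Omega> u x *v w x) \<bullet> u x"
  let ?b = "\<lambda>x. (1/2) * Div \<Omega> w x * (norm (u x))\<^sup>2"
  have D: "L2 \<Omega> (Div \<Omega> w)"
    unfolding Div_def[abs_def] by (rule L2_trace[OF Gw(2)])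
  have mu: "u \<in> borel_measurable (lebesgue_on \<Omega>)" by (rule L2_measurable[OF Gu(1)])
  have b: "integrable (lebesgue_on \<Omega>) ?b"
    by (rule L2_product_integrable[OF D H10_norm_sq_L2[OF dim \<Omega> u], where C = "1/2"])
       (use L2_measurable[OF D] mu in \<open>auto simp: abs_mult\<close>)
  have ab: "integrable (lebesgue_on \<Omega>) (\<lambda>x. ?a x + ?b x)"
    using True by (simp add: dot_square_norm)
  \<comment> \<open>The sum is integrable by the case assumption and the divergence part by the
    fourth-power bound, so the convective part is integrable by itself and can enter the
    majorant.\<close>
  have a: "integrable (lebesgue_on \<Omega>) ?a"
    using Bochner_Integration.integrable_diff[OF ab b] by simp
  define \<delta> where "\<delta> m = 1 / real (Suc m)" for m
  have \<delta>: "0 < \<delta> m" for m by (simp add: \<delta>_def)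
  have \<delta>0: "\<delta> \<longlonglongrightarrow> 0" unfolding \<delta>_def by (intro LIMSEQ_Suc lim_1_over_n)
  \<comment> \<open>The powers differ because the convective part carries the square from the chain
    rule, while \<open>one_minus_cutoff\<close> leaves a single factor on the divergence part. Both
    factors are at most 1 and tend to 1.\<close>
  let ?s = "\<lambda>m x. (cutoff (\<delta> m) (u x))\<^sup>2 * ?a x + cutoff (\<delta> m) (u x) * ?b x"
  have zero: "omint \<Omega> (?s m) = 0" for m
  proof -
    have "?s m = (\<lambda>x. (cutoff (\<delta> m) (u x))\<^sup>2 * ?a x
       + (\<Sum>j\<in>UNIV. Grad \<Omega> w x $ j $ j) * (1 / (2 * \<delta> m) * (1 - cutoff (\<delta> m) (u x))))"
      unfolding one_minus_cutoff[OF \<delta>] by (simp add: Div_def mult_ac)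
    then show ?thesis using truncated_identity[OF \<Omega> \<delta> Gw u] by simp
  qed
  have "(\<lambda>m. omint \<Omega> (?s m)) \<longlonglongrightarrow> omint \<Omega> (\<lambda>x. ?a x + ?b x)"
  proof (rule integral_dominated_convergence[where w = "\<lambda>x. \<bar>?a x\<bar> + \<bar>?b x\<bar>"])
    show "(\<lambda>x. ?a x + ?b x) \<in> borel_measurable (lebesgue_on \<Omega>)"
      by (rule borel_measurable_integrable[OF ab])
    show "?s m \<in> borel_measurable (lebesgue_on \<Omega>)" for m
      by (intro borel_measurable_add borel_measurable_times borel_measurable_power
          cutoff_borel_measurable \<delta> mu borel_measurable_integrable[OF a] borel_measurable_integrable[OF b])
    show "integrable (lebesgue_on \<Omega>) (\<lambda>x. \<bar>?a x\<bar> + \<bar>?b x\<bar>)"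
      by (intro Bochner_Integration.integrable_add integrable_abs a b)
    have "\<bar>?s m x\<bar> \<le> \<bar>?a x\<bar> + \<bar>?b x\<bar>" for m x
    proof -
      note c = cutoff_bounds[OF \<delta>, of m "u x"]
      have "\<bar>(cutoff (\<delta> m) (u x))\<^sup>2 * ?a x\<bar> \<le> 1 * \<bar>?a x\<bar>"
        unfolding abs_mult by (rule mult_right_mono) (use c in auto)
      moreover have "\<bar>cutoff (\<delta> m) (u x) * ?b x\<bar> \<le> 1 * \<bar>?b x\<bar>"
        unfolding abs_mult[of "cutoff _ _"] by (rule mult_right_mono) (use c in auto)
      ultimately show ?thesis by linarith
    qed
    then show "AE x in lebesgue_on \<Omega>. norm (?s m x) \<le> \<bar>?a x\<bar> + \<bar>?b x\<bar>" for m
      by (intro AE_I2) simp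
    have "(\<lambda>m. ?s m x) \<longlonglongrightarrow> ?a x + ?b x" for x
    proof -
      have "(\<lambda>m. cutoff (\<delta> m) (u x)) \<longlonglongrightarrow> inverse (1 + 0 * (norm (u x))\<^sup>2)"
        unfolding cutoff_def using \<delta>0 by (intro tendsto_intros) auto
      then have "(\<lambda>m. cutoff (\<delta> m) (u x)) \<longlonglongrightarrow> 1" by simp
      then have "(\<lambda>m. ?s m x) \<longlonglongrightarrow> 1\<^sup>2 * ?a x + 1 * ?b x"
        by (intro tendsto_intros)
      then show ?thesis by simp
    qed
    then show "AE x in lebesgue_on \<Omega>. (\<lambda>m. ?s m x) \<longlonglongrightarrow> ?a x + ?b x"
      by (intro AE_I2)
  qed
  then have "omint \<Omega> (\<lambda>x. ?a x + ?b x) = 0"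
    unfolding zero by (simp add: LIMSEQ_const_iff)
  then show ?thesis by (simp add: bstar_def dot_square_norm)
qed

subsection \<open>Energy balance\<close>

text \<open>The constant in \<open>Hm1\<close> bounds the set of quotients, so its supremum is an
  upper bound. Fields with zero gradient norm are excluded from that set, and for them the same
  constant forces \<open>F v = 0\<close>.\<close>

lemma Hm1_le_dual_norm:
  assumes F: "Hm1 \<Omega> F" and v: "H10 \<Omega> v"
  shows "F v \<le> dual_norm \<Omega> F * grad_norm \<Omega> v"
proof -
  obtain C where C: "\<And>v. H10 \<Omega> v \<Longrightarrow> \<bar>F v\<bar> \<le> C * grad_norm \<Omega> v"
    using F by (auto simp: Hm1_def)
  have nonneg: "0 \<le> grad_norm \<Omega> v" for v
    unfolding grad_norm_def by (simp add: Bochner_Integration.integral_nonneg)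
  show ?thesis
  proof (cases "grad_norm \<Omega> v = 0")
    case True
    then show ?thesis using C[OF v] by simp
  next
    case False
    then have pos: "0 < grad_norm \<Omega> v" using nonneg[of v] by simp
    let ?S = "{\<bar>F v\<bar> / grad_norm \<Omega> v | v. H10 \<Omega> v \<and> grad_norm \<Omega> v \<noteq> 0}"
    have "bdd_above ?S"
    proof (rule bdd_aboveI[of _ C])
      fix y assume "y \<in> ?S"
      then obtain v where v: "H10 \<Omega> v" "grad_norm \<Omega> v \<noteq> 0" and y: "y = \<bar>F v\<bar> / grad_norm \<Omega> v"
        by blast
      then have "0 < grad_norm \<Omega> v" using nonneg[of v] by simp
      then show "y \<le> C" using C[OF v(1)] by (simp add: y divide_le_eq)
    qed
    moreover have "\<bar>F v\<bar> / grad_norm \<Omega> v \<in> ?S" using v False by blast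
    ultimately have "\<bar>F v\<bar> / grad_norm \<Omega> v \<le> dual_norm \<Omega> F"
      unfolding dual_norm_def by (intro cSup_upper)
    then show ?thesis using pos by (simp add: divide_le_eq)
  qed
qed

lemma L2_omint_norm_diff_sq:
  assumes "L2 \<Omega> f" "L2 \<Omega> g"
  shows "omint \<Omega> (\<lambda>x. (norm (f x - g x))\<^sup>2) =
    omint \<Omega> (\<lambda>x. (norm (f x))\<^sup>2) - 2 * omint \<Omega> (\<lambda>x. f x \<bullet> g x) + omint \<Omega> (\<lambda>x. (norm (g x))\<^sup>2)"
proof -
  have "omint \<Omega> (\<lambda>x. (norm (f x - g x))\<^sup>2) =
      omint \<Omega> (\<lambda>x. (norm (f x))\<^sup>2 - 2 * (f x \<bullet> g x) + (norm (g x))\<^sup>2)"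
    by (intro Bochner_Integration.integral_cong refl)
       (simp add: power2_norm_eq_inner inner_diff_left inner_diff_right inner_commute)
  then show ?thesis
    using assms by (simp add: L2_inner_integrable L2_square_integrable)
qed

text \<open>Once the integrals are named, the first claim is scalar algebra: the two tested
  equations are added, the pressure-divergence terms cancel, and polarization turns the mixed
  products into differences of squares. The second claim sets aside half of the viscous dissipation
  to absorb the forcing.\<close>

lemma GA_step_energy:
  fixes \<Omega> :: "(real^'d::finite) set"
  assumes dim: "CARD('d) = 2 \<or> CARD('d) = 3"
    and \<Omega>: "open \<Omega>" "bounded \<Omega>"
    and pos: "k (Suc n) > 0" "\<epsilon> n > 0" "\<epsilon> (Suc n) > 0"
    and U: "H10 \<Omega> (u (Suc n))" and V: "H1 \<Omega> (u n)" and W: "H1 \<Omega> (if n = 0 then um1 else u (n - 1))"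
    and P: "L2 \<Omega> (p (Suc n))" and Q: "L2 \<Omega> (p n)"
    and GA: "GA_step \<Omega> \<nu> k \<epsilon> F u um1 p n"
  shows "(1/2) * omint \<Omega> (\<lambda>x. (norm (u (Suc n) x))\<^sup>2 + \<epsilon> (Suc n) * (p (Suc n) x)\<^sup>2)
     + (1/2) * omint \<Omega> (\<lambda>x. (norm (u (Suc n) x - u n x))\<^sup>2
          + (sqrt (\<epsilon> (Suc n)) * p (Suc n) x - sqrt (\<epsilon> n) * p n x)\<^sup>2
          + 2 * k (Suc n) * \<nu> * (norm (Grad \<Omega> (u (Suc n)) x))\<^sup>2)
     = (1/2) * omint \<Omega> (\<lambda>x. (norm (u n x))\<^sup>2 + \<epsilon> n * (p n x)\<^sup>2) + k (Suc n) * F (Suc n) (u (Suc n))"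
    and "(1/2) * omint \<Omega> (\<lambda>x. (norm (u (Suc n) x - u n x))\<^sup>2
          + (sqrt (\<epsilon> (Suc n)) * p (Suc n) x - sqrt (\<epsilon> n) * p n x)\<^sup>2
          + 2 * k (Suc n) * \<nu> * (norm (Grad \<Omega> (u (Suc n)) x))\<^sup>2)
     = (1/2) * omint \<Omega> (\<lambda>x. (norm (u (Suc n) x - u n x))\<^sup>2
          + (sqrt (\<epsilon> (Suc n)) * p (Suc n) x - sqrt (\<epsilon> n) * p n x)\<^sup>2
          + k (Suc n) * \<nu> * (norm (Grad \<Omega> (u (Suc n)) x))\<^sup>2)
       + k (Suc n) * \<nu> / 2 * (grad_norm \<Omega> (u (Suc n)))\<^sup>2"
proof -
  note GU = H1_Grad[OF H10_imp_H1[OF U]] and GV = H1_Grad[OF V]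
  \<comment> \<open>With these roots the mixed coefficient of the continuity equation factors as
    \<alpha>\<beta>, the cross coefficient in the square of \<alpha>p - \<beta>q for the new and old
    pressures p and q.\<close>
  define \<alpha> \<beta> where "\<alpha> = sqrt (\<epsilon> (Suc n))" and "\<beta> = sqrt (\<epsilon> n)"
  have \<alpha>: "\<epsilon> (Suc n) = \<alpha>\<^sup>2" and \<beta>: "\<epsilon> n = \<beta>\<^sup>2" and \<alpha>\<beta>: "sqrt (\<epsilon> (Suc n) * \<epsilon> n) = \<alpha> * \<beta>"
    using pos by (auto simp: \<alpha>_def \<beta>_def real_sqrt_mult)
  have D: "L2 \<Omega> (Div \<Omega> (u (Suc n)))"
    unfolding Div_def[abs_def] by (rule L2_trace[OF GU(2)])
  define K where "K = k (Suc n)"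
  have K: "K > 0" using pos by (simp add: K_def)
  define a b c g where "a = omint \<Omega> (\<lambda>x. (norm (u (Suc n) x))\<^sup>2)"
    and "b = omint \<Omega> (\<lambda>x. u (Suc n) x \<bullet> u n x)"
    and "c = omint \<Omega> (\<lambda>x. (norm (u n x))\<^sup>2)"
    and "g = omint \<Omega> (\<lambda>x. (norm (Grad \<Omega> (u (Suc n)) x))\<^sup>2)"
  define pp pq qq d where "pp = omint \<Omega> (\<lambda>x. (p (Suc n) x)\<^sup>2)"
    and "pq = omint \<Omega> (\<lambda>x. p (Suc n) x * p n x)"
    and "qq = omint \<Omega> (\<lambda>x. (p n x)\<^sup>2)"
    and "d = omint \<Omega> (\<lambda>x. p (Suc n) x * Div \<Omega> (u (Suc n)) x)"
  note sq = L2_square_integrable[OF GU(1)] L2_square_integrable[OF GV(1)] L2_square_integrable[OF GU(2)]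
  have sqp: "integrable (lebesgue_on \<Omega>) (\<lambda>x. (p (Suc n) x)\<^sup>2)" "integrable (lebesgue_on \<Omega>) (\<lambda>x. (p n x)\<^sup>2)"
    "integrable (lebesgue_on \<Omega>) (\<lambda>x. p (Suc n) x * p n x)"
    using L2_square_integrable[OF P] L2_square_integrable[OF Q] L2_inner_integrable[OF P Q] by auto
  have "H1 \<Omega> (ustar k u um1 n)"
  proof -
    have "ustar k u um1 n = (\<lambda>x. (1 + k (Suc n) / k n) *\<^sub>R u n x
        + (- (k (Suc n) / k n)) *\<^sub>R (if n = 0 then um1 else u (n - 1)) x)"
      by (auto simp: ustar_def fun_eq_iff)
    then show ?thesis by (simp only: H1_linear_combination[OF \<Omega> V W])
  qed
  then have "bstar \<Omega> (ustar k u um1 n) (u (Suc n)) (u (Suc n)) = 0"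
    by (rule bstar_self_eq_0[OF dim \<Omega> U])
  moreover have "omint \<Omega> (\<lambda>x. ((1 / k (Suc n)) *\<^sub>R (u (Suc n) x - u n x)) \<bullet> u (Suc n) x) = (a - b) / K"
  proof -
    have "omint \<Omega> (\<lambda>x. ((1 / k (Suc n)) *\<^sub>R (u (Suc n) x - u n x)) \<bullet> u (Suc n) x)
        = omint \<Omega> (\<lambda>x. 1 / K * ((norm (u (Suc n) x))\<^sup>2 - u (Suc n) x \<bullet> u n x))"
      by (intro Bochner_Integration.integral_cong refl)
         (simp add: K_def power2_norm_eq_inner inner_diff_left inner_commute[of "u n _"])
    also have "\<dots> = 1 / K * (a - b)"
      using sq L2_inner_integrable[OF GU(1) GV(1)] unfolding a_def b_def by simp
    finally show ?thesis by simp
  qed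
  moreover have "omint \<Omega> (\<lambda>x. Grad \<Omega> (u (Suc n)) x \<bullet> Grad \<Omega> (u (Suc n)) x) = g"
    by (simp add: g_def power2_norm_eq_inner)
  ultimately have mom: "(a - b) / K - d + \<nu> * g = F (Suc n) (u (Suc n))"
    using conjunct1[OF GA[unfolded GA_step_def], rule_format, OF U] by (simp add: d_def)
  have "omint \<Omega> (\<lambda>x. (\<epsilon> (Suc n) * p (Suc n) x - sqrt (\<epsilon> (Suc n) * \<epsilon> n) * p n x) / k (Suc n) * p (Suc n) x)
      = omint \<Omega> (\<lambda>x. \<alpha>\<^sup>2 / K * (p (Suc n) x)\<^sup>2 - \<alpha> * \<beta> / K * (p (Suc n) x * p n x))"
    unfolding \<alpha>\<beta> unfolding \<alpha> K_def[symmetric]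
    by (intro Bochner_Integration.integral_cong refl) (simp add: power2_eq_square diff_divide_distrib algebra_simps)
  also have "\<dots> = \<alpha>\<^sup>2 / K * pp - \<alpha> * \<beta> / K * pq"
    using sqp unfolding pp_def pq_def by simp
  finally have cont: "\<alpha>\<^sup>2 / K * pp - \<alpha> * \<beta> / K * pq + d = 0"
    using conjunct2[OF GA[unfolded GA_step_def], rule_format, OF P] by (simp add: d_def mult.commute)
  have R: "integrable (lebesgue_on \<Omega>) (\<lambda>x. (norm (u (Suc n) x - u n x))\<^sup>2)"
    "integrable (lebesgue_on \<Omega>) (\<lambda>x. (\<alpha> * p (Suc n) x - \<beta> * p n x)\<^sup>2)"
    using L2_square_integrable[OF L2_diff[OF GU(1) GV(1)]]
      L2_square_integrable[OF L2_diff[OF L2_scaleR[OF P, of \<alpha>] L2_scaleR[OF Q, of \<beta>]]] by auto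
  \<comment> \<open>The dissipation in the equality and in the bound differs only in the viscous
    coefficient, so \<open>C\<close> is left free.\<close>
  have diss: "omint \<Omega> (\<lambda>x. (norm (u (Suc n) x - u n x))\<^sup>2
      + (sqrt (\<epsilon> (Suc n)) * p (Suc n) x - sqrt (\<epsilon> n) * p n x)\<^sup>2
      + C * (norm (Grad \<Omega> (u (Suc n)) x))\<^sup>2)
      = (a - 2 * b + c) + (\<alpha>\<^sup>2 * pp - 2 * (\<alpha> * \<beta>) * pq + \<beta>\<^sup>2 * qq) + C * g" for C
  proof -
    have "omint \<Omega> (\<lambda>x. (\<alpha> * p (Suc n) x - \<beta> * p n x)\<^sup>2)
        = omint \<Omega> (\<lambda>x. \<alpha>\<^sup>2 * (p (Suc n) x)\<^sup>2 - 2 * (\<alpha> * \<beta>) * (p (Suc n) x * p n x) + \<beta>\<^sup>2 * (p n x)\<^sup>2)"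
      by (intro Bochner_Integration.integral_cong refl) (simp add: power2_eq_square algebra_simps)
    also have "\<dots> = \<alpha>\<^sup>2 * pp - 2 * (\<alpha> * \<beta>) * pq + \<beta>\<^sup>2 * qq"
      using sqp unfolding pp_def pq_def qq_def by simp
    finally show ?thesis
      using R sq L2_omint_norm_diff_sq[OF GU(1) GV(1)]
      unfolding \<alpha>_def[symmetric] \<beta>_def[symmetric] a_def b_def c_def g_def by simp
  qed
  have ener: "omint \<Omega> (\<lambda>x. (norm (u (Suc n) x))\<^sup>2 + \<epsilon> (Suc n) * (p (Suc n) x)\<^sup>2) = a + \<alpha>\<^sup>2 * pp"
    "omint \<Omega> (\<lambda>x. (norm (u n x))\<^sup>2 + \<epsilon> n * (p n x)\<^sup>2) = c + \<beta>\<^sup>2 * qq"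
    unfolding \<alpha> \<beta> using sq sqp by (simp_all add: a_def c_def pp_def qq_def)
  \<comment> \<open>Both equations are multiplied by the time step; in their sum the terms
    \<open>K * d\<close> cancel.\<close>
  have "K * ((a - b) / K - d + \<nu> * g) = a - b - K * d + K * \<nu> * g"
    using K by (simp add: field_simps)
  moreover have "K * (\<alpha>\<^sup>2 / K * pp - \<alpha> * \<beta> / K * pq + d) = \<alpha>\<^sup>2 * pp - \<alpha> * \<beta> * pq + K * d"
    using K by (simp add: field_simps)
  ultimately have "K * F (Suc n) (u (Suc n)) = (a - b) + (\<alpha>\<^sup>2 * pp - \<alpha> * \<beta> * pq) + K * \<nu> * g"
    unfolding mom cont by simp
  then show "(1/2) * omint \<Omega> (\<lambda>x. (norm (u (Suc n) x))\<^sup>2 + \<epsilon> (Suc n) * (p (Suc n) x)\<^sup>2)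
     + (1/2) * omint \<Omega> (\<lambda>x. (norm (u (Suc n) x - u n x))\<^sup>2
          + (sqrt (\<epsilon> (Suc n)) * p (Suc n) x - sqrt (\<epsilon> n) * p n x)\<^sup>2
          + 2 * k (Suc n) * \<nu> * (norm (Grad \<Omega> (u (Suc n)) x))\<^sup>2)
     = (1/2) * omint \<Omega> (\<lambda>x. (norm (u n x))\<^sup>2 + \<epsilon> n * (p n x)\<^sup>2) + k (Suc n) * F (Suc n) (u (Suc n))"
    unfolding diss ener K_def[symmetric] by (simp add: algebra_simps)
  have "0 \<le> g" unfolding g_def by (simp add: Bochner_Integration.integral_nonneg)
  then have "(grad_norm \<Omega> (u (Suc n)))\<^sup>2 = g" by (simp add: grad_norm_def g_def)
  then show "(1/2) * omint \<Omega> (\<lambda>x. (norm (u (Suc n) x - u n x))\<^sup>2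
          + (sqrt (\<epsilon> (Suc n)) * p (Suc n) x - sqrt (\<epsilon> n) * p n x)\<^sup>2
          + 2 * k (Suc n) * \<nu> * (norm (Grad \<Omega> (u (Suc n)) x))\<^sup>2)
     = (1/2) * omint \<Omega> (\<lambda>x. (norm (u (Suc n) x - u n x))\<^sup>2
          + (sqrt (\<epsilon> (Suc n)) * p (Suc n) x - sqrt (\<epsilon> n) * p n x)\<^sup>2
          + k (Suc n) * \<nu> * (norm (Grad \<Omega> (u (Suc n)) x))\<^sup>2)
       + k (Suc n) * \<nu> / 2 * (grad_norm \<Omega> (u (Suc n)))\<^sup>2"
    unfolding diss by (simp add: algebra_simps)
qed

text \<open>The weight is chosen so that the second term is exactly half of the viscous dissipation;
  the difference of the two sides is the square (x - \<nu>y)^2/(2\<nu>).\<close>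

lemma young_dual_pairing:
  fixes x y \<nu> :: real
  assumes "0 < \<nu>"
  shows "x * y \<le> 1 / (2 * \<nu>) * x\<^sup>2 + \<nu> / 2 * y\<^sup>2"
proof -
  have "0 \<le> (x - \<nu> * y)\<^sup>2 / (2 * \<nu>)" using assms by simp
  also have "\<dots> = 1 / (2 * \<nu>) * x\<^sup>2 + \<nu> / 2 * y\<^sup>2 - x * y"
    using assms by (simp add: power2_eq_square field_simps)
  finally show ?thesis by simp
qed

theorem theorem2p2:
  fixes \<Omega> :: "(real^'d::finite) set"
    and \<nu> :: real
    and k \<epsilon> :: "nat \<Rightarrow> real"
    and F :: "nat \<Rightarrow> (real^'d \<Rightarrow> real^'d) \<Rightarrow> real"
    and u :: "nat \<Rightarrow> real^'d \<Rightarrow> real^'d"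
    and um1 :: "real^'d \<Rightarrow> real^'d"
    and p :: "nat \<Rightarrow> real^'d \<Rightarrow> real"
    and N :: nat
  assumes dim: "CARD('d) = 2 \<or> CARD('d) = 3"
    and dom: "regular_domain \<Omega>"
    and nu: "\<nu> > 0"
    and k_pos: "\<And>n. k n > 0"
    and eps_pos: "\<And>n. \<epsilon> n > 0"
    and f: "\<And>n. n \<ge> 1 \<Longrightarrow> Hm1 \<Omega> (F n)"
    and u0: "H1 \<Omega> (u 0)"
    and um1: "H1 \<Omega> um1"
    and p0: "L2 \<Omega> (p 0)"
    and u_sp: "\<And>n. n \<ge> 1 \<Longrightarrow> H10 \<Omega> (u n)"
    and p_sp: "\<And>n. n \<ge> 1 \<Longrightarrow> L2 \<Omega> (p n)"
    and GA: "\<And>n. GA_step \<Omega> \<nu> k \<epsilon> F u um1 p n"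
    and N: "N > 0"
  shows
    "((1/2) * omint \<Omega> (\<lambda>x. (norm (u N x))\<^sup>2 + \<epsilon> N * (p N x)\<^sup>2)
     + (\<Sum>n<N. (1/2) * omint \<Omega> (\<lambda>x. (norm (u (Suc n) x - u n x))\<^sup>2
          + (sqrt (\<epsilon> (Suc n)) * p (Suc n) x - sqrt (\<epsilon> n) * p n x)\<^sup>2
          + 2 * k (Suc n) * \<nu> * (norm (Grad \<Omega> (u (Suc n)) x))\<^sup>2))
     = (1/2) * omint \<Omega> (\<lambda>x. (norm (u 0 x))\<^sup>2 + \<epsilon> 0 * (p 0 x)\<^sup>2)
       + (\<Sum>n<N. k (Suc n) * F (Suc n) (u (Suc n)))) \<and>
    ((1/2) * omint \<Omega> (\<lambda>x. (norm (u N x))\<^sup>2 + \<epsilon> N * (p N x)\<^sup>2)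
     + (\<Sum>n<N. (1/2) * omint \<Omega> (\<lambda>x. (norm (u (Suc n) x - u n x))\<^sup>2
          + (sqrt (\<epsilon> (Suc n)) * p (Suc n) x - sqrt (\<epsilon> n) * p n x)\<^sup>2
          + k (Suc n) * \<nu> * (norm (Grad \<Omega> (u (Suc n)) x))\<^sup>2))
     \<le> (1/2) * omint \<Omega> (\<lambda>x. (norm (u 0 x))\<^sup>2 + \<epsilon> 0 * (p 0 x)\<^sup>2)
       + (\<Sum>n<N. k (Suc n) * (1 / (2 * \<nu>)) * (dual_norm \<Omega> (F (Suc n)))\<^sup>2))"
proof -
  have \<Omega>: "open \<Omega>" "bounded \<Omega>" using dom by (auto simp: regular_domain_def)
  have uH1: "H1 \<Omega> (u n)" for n
    using u0 u_sp[of n] by (cases n) (auto intro: H10_imp_H1)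
  have pL2: "L2 \<Omega> (p n)" for n
    using p0 p_sp[of n] by (cases n) auto
  \<comment> \<open>At step 0 the predecessor is the separate datum \<open>um1\<close>; natural
    subtraction would return \<open>u 0\<close> instead.\<close>
  have W: "H1 \<Omega> (if n = 0 then um1 else u (n - 1))" for n
    using um1 uH1 by simp
  define E where "E n = (1/2) * omint \<Omega> (\<lambda>x. (norm (u n x))\<^sup>2 + \<epsilon> n * (p n x)\<^sup>2)" for n
  define S where "S n = (1/2) * omint \<Omega> (\<lambda>x. (norm (u (Suc n) x - u n x))\<^sup>2
          + (sqrt (\<epsilon> (Suc n)) * p (Suc n) x - sqrt (\<epsilon> n) * p n x)\<^sup>2
          + 2 * k (Suc n) * \<nu> * (norm (Grad \<Omega> (u (Suc n)) x))\<^sup>2)" for n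
  define R where "R n = (1/2) * omint \<Omega> (\<lambda>x. (norm (u (Suc n) x - u n x))\<^sup>2
          + (sqrt (\<epsilon> (Suc n)) * p (Suc n) x - sqrt (\<epsilon> n) * p n x)\<^sup>2
          + k (Suc n) * \<nu> * (norm (Grad \<Omega> (u (Suc n)) x))\<^sup>2)" for n
  have U: "H10 \<Omega> (u (Suc n))" for n using u_sp by simp
  note step = GA_step_energy[OF dim \<Omega> k_pos eps_pos eps_pos U uH1 W pL2 pL2 GA,
      folded E_def S_def R_def]
  \<comment> \<open>Summing the one-step identities telescopes the energies
    \<open>E\<close>.\<close>
  have eq: "E M + (\<Sum>n<M. S n) = E 0 + (\<Sum>n<M. k (Suc n) * F (Suc n) (u (Suc n)))" for M
  proof (induction M)
    case (Suc M)
    then show ?case using step(1)[of M] by simp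
  qed simp
  \<comment> \<open>\<open>S n - R n\<close> is the reserved half of the viscous dissipation, which
    cancels the gradient term produced by Young's inequality.\<close>
  have "k (Suc n) * F (Suc n) (u (Suc n)) - (S n - R n)
      \<le> k (Suc n) * (1 / (2 * \<nu>)) * (dual_norm \<Omega> (F (Suc n)))\<^sup>2" for n
  proof -
    let ?d = "dual_norm \<Omega> (F (Suc n))" and ?g = "grad_norm \<Omega> (u (Suc n))"
    have "F (Suc n) (u (Suc n)) \<le> ?d * ?g"
      by (rule Hm1_le_dual_norm[OF f U]) simp
    also have "\<dots> \<le> 1 / (2 * \<nu>) * ?d\<^sup>2 + \<nu> / 2 * ?g\<^sup>2"
      by (rule young_dual_pairing[OF nu])
    finally have "k (Suc n) * F (Suc n) (u (Suc n)) \<le> k (Suc n) * (1 / (2 * \<nu>) * ?d\<^sup>2 + \<nu> / 2 * ?g\<^sup>2)"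
      using k_pos[of "Suc n"] by (intro mult_left_mono) auto
    then show ?thesis using step(2)[of n] by (simp add: algebra_simps)
  qed
  then have "(\<Sum>n<N. k (Suc n) * F (Suc n) (u (Suc n)) - (S n - R n))
      \<le> (\<Sum>n<N. k (Suc n) * (1 / (2 * \<nu>)) * (dual_norm \<Omega> (F (Suc n)))\<^sup>2)"
    by (rule sum_mono)
  then have "E N + (\<Sum>n<N. R n) \<le> E 0 + (\<Sum>n<N. k (Suc n) * (1 / (2 * \<nu>)) * (dual_norm \<Omega> (F (Suc n)))\<^sup>2)"
    using eq[of N] by (simp add: sum_subtractf)
  with eq[of N] show ?thesis
    unfolding E_def S_def R_def by (rule conjI)
qed

end
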